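(* Let $X\subset\mathbb{R}^2$ be an ellipse which is not a circle. (1) The closure $\overline{T}$ of the space $T$ of orthotripods on $X$ is homeomorphic to a cylinder (with two boundary circles). (2) The space of orthotripods on $X$ which can be balanced by positive charges only is homeomorphic to a cylinder.
   Context: An orthotripod on $X$ is an unordered triple of distinct points of $X$ such that the three normal lines to $X$ at these points are concurrent. The space $T$ of orthotripods is a subspace of the space of all unordered triples of points on the curve, i.e. of the symmetric cube $X^3/S_3$ of $X\cong S^1$ (with the quotient topology), and $\overline{T}$ is the closure of $T$ taken in this symmetric cube. An orthotripod $\{P_1,P_2,P_3\}$ can be balanced by positive charges if there are $q_1,q_2,q_3>0$ such that, at each $P_i$, the resultant of the Coulomb forces is orthogonal to the tangent vector $T_i$ of $X$ at $P_i$, i.e. $\sum_{j\neq i}\frac{q_iq_j}{d_{ij}^3}\langle p_i-p_j,T_i\rangle=0$ for $i=1,2,3$, where $p_i$ is the position vector of $P_i$ and $d_{ij}=\|p_i-p_j\|$. A cylinder is the product of a circle $S^1$ with a nondegenerate interval; the cylinder with two boundary circles is $S^1\times[0,1]$. *)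

theory Defs
  imports "HOL-Analysis.Analysis" "HOL-Library.Multiset"
begin

text \<open>Ellipses and circles in arbitrary position: \<open>c\<close> is the centre, \<open>u\<close>, \<open>v\<close> are unit vectors
  along the axes and \<open>a\<close>, \<open>b\<close> are the semi-axes.\<close>

definition is_ellipse :: "(real^2) set \<Rightarrow> bool" where
  "is_ellipse X \<longleftrightarrow> (\<exists>c u v a b. norm u = 1 \<and> norm v = 1 \<and> orthogonal u v \<and> 0 < a \<and> 0 < b \<and>
     X = {p. (((p - c) \<bullet> u) / a)\<^sup>2 + (((p - c) \<bullet> v) / b)\<^sup>2 = 1})"

definition is_circle :: "(real^2) set \<Rightarrow> bool" where
  "is_circle X \<longleftrightarrow> (\<exists>c r. 0 < r \<and> X = sphere c r)"

text \<open>Tangent vectors are the velocities of curves running in \<open>X\<close>; the zero vector is included, so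
  that for a smooth curve \<open>X\<close> the tangent vectors at a point form the tangent line through the
  origin.\<close>

definition tangent_vector :: "(real^2) set \<Rightarrow> real^2 \<Rightarrow> real^2 \<Rightarrow> bool" where
  "tangent_vector X p v \<longleftrightarrow>
     (\<exists>\<gamma>. range \<gamma> \<subseteq> X \<and> \<gamma> 0 = p \<and> (\<gamma> has_vector_derivative v) (at (0::real)))"

definition normal_line :: "(real^2) set \<Rightarrow> real^2 \<Rightarrow> (real^2) set" where
  "normal_line X p = {x. \<forall>v. tangent_vector X p v \<longrightarrow> orthogonal (x - p) v}"

text \<open>The symmetric cube: an orbit of \<open>S\<^sub>3\<close> on triples is represented by the multiset of its
  coordinates, and the set of these multisets carries the quotient topology.\<close>

definition unordered :: "'a \<times> 'a \<times> 'a \<Rightarrow> 'a multiset" where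
  "unordered = (\<lambda>(x, y, z). {#x, y, z#})"

abbreviation cube_topology :: "'a topology \<Rightarrow> ('a \<times> 'a \<times> 'a) topology" where
  "cube_topology X \<equiv> prod_topology X (prod_topology X X)"

definition sym_cube :: "'a topology \<Rightarrow> 'a multiset topology" where
  "sym_cube X = topology (\<lambda>U. U \<subseteq> unordered ` topspace (cube_topology X) \<and>
     openin (cube_topology X) {t \<in> topspace (cube_topology X). unordered t \<in> U})"

lemma openin_sym_cube:
  "openin (sym_cube X) U \<longleftrightarrow> U \<subseteq> unordered ` topspace (cube_topology X) \<and>
     openin (cube_topology X) {t \<in> topspace (cube_topology X). unordered t \<in> U}"
proof -
  let ?T = "topspace (cube_topology X)"
  let ?O = "\<lambda>U. U \<subseteq> unordered ` ?T \<and> openin (cube_topology X) {t \<in> ?T. unordered t \<in> U}"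
  have "istopology ?O"
    unfolding istopology_def
  proof (intro conjI allI impI)
    fix S U assume S: "?O S" and U: "?O U"
    have "{t \<in> ?T. unordered t \<in> S \<inter> U} = {t \<in> ?T. unordered t \<in> S} \<inter> {t \<in> ?T. unordered t \<in> U}"
      by blast
    then show "openin (cube_topology X) {t \<in> ?T. unordered t \<in> S \<inter> U}"
      using S U by (metis (no_types, lifting) openin_Int)
    show "S \<inter> U \<subseteq> unordered ` ?T" using S by blast
  next
    fix K assume K: "\<forall>S\<in>K. ?O S"
    have "{t \<in> ?T. unordered t \<in> \<Union>K} = (\<Union>S\<in>K. {t \<in> ?T. unordered t \<in> S})"
      by blast
    moreover have "openin (cube_topology X) (\<Union>S\<in>K. {t \<in> ?T. unordered t \<in> S})"
      using K by (intro openin_Union) blast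
    ultimately show "openin (cube_topology X) {t \<in> ?T. unordered t \<in> \<Union>K}"
      by (metis (no_types, lifting))
    show "\<Union>K \<subseteq> unordered ` ?T" using K by blast
  qed
  then show ?thesis
    unfolding sym_cube_def by (simp only: topology_inverse')
qed

lemma topspace_sym_cube: "topspace (sym_cube X) = unordered ` topspace (cube_topology X)"
proof
  show "topspace (sym_cube X) \<subseteq> unordered ` topspace (cube_topology X)"
    using openin_sym_cube[of X "topspace (sym_cube X)"] by blast
  have "{t \<in> topspace (cube_topology X). unordered t \<in> unordered ` topspace (cube_topology X)}
      = topspace (cube_topology X)"
    by blast
  then have "openin (sym_cube X) (unordered ` topspace (cube_topology X))"
    unfolding openin_sym_cube by (metis (no_types, lifting) openin_topspace order_refl)
  then show "unordered ` topspace (cube_topology X) \<subseteq> topspace (sym_cube X)"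
    by (rule openin_subset)
qed

lemma quotient_map_unordered: "quotient_map (cube_topology X) (sym_cube X) unordered"
  unfolding quotient_map_def topspace_sym_cube openin_sym_cube by blast

definition orthotripods :: "(real^2) set \<Rightarrow> (real^2) multiset set" where
  "orthotripods X = {P. size P = 3 \<and> card (set_mset P) = 3 \<and> set_mset P \<subseteq> X \<and>
     (\<exists>x. \<forall>p \<in># P. x \<in> normal_line X p)}"

text \<open>The points of an orthotripod are distinct, so charges can be given as a function on them.\<close>

definition coulomb_force :: "(real^2 \<Rightarrow> real) \<Rightarrow> (real^2) set \<Rightarrow> real^2 \<Rightarrow> real^2" where
  "coulomb_force q A p = (\<Sum>r \<in> A - {p}. (q p * q r / dist p r ^ 3) *\<^sub>R (p - r))"

definition positively_balanced :: "(real^2) set \<Rightarrow> (real^2) multiset \<Rightarrow> bool" where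
  "positively_balanced X P \<longleftrightarrow> (\<exists>q. (\<forall>p \<in># P. 0 < q p) \<and>
     (\<forall>p \<in># P. \<forall>v. tangent_vector X p v \<longrightarrow> orthogonal (coulomb_force q (set_mset P) p) v))"

abbreviation cylinder :: "real set \<Rightarrow> (complex \<times> real) topology" where
  "cylinder I \<equiv> prod_topology (top_of_set (sphere 0 1)) (top_of_set I)"

end

theory Submission
  imports Defs "HOL-Computational_Algebra.Fundamental_Theorem_Algebra"
begin

text \<open>In coordinates that turn the ellipse into the unit circle of the complex plane, an unordered
  triple \<open>{x, y, z}\<close> is determined by \<open>w = xyz\<close> and \<open>e = xy + yz + zx\<close>, because \<open>x + y + z = w * cnj e\<close>.
  The feet of the normals through a point are the unit roots of a quartic without quadratic term, and
  comparing coefficients shows that the normals at distinct \<open>x, y, z\<close> concur iff \<open>e = r\<close> is real. So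
  orthotripods are the cubics \<open>t\<^sup>3 - r w t\<^sup>2 + r t - w\<close> with three distinct roots on the circle, i.e. those
  whose normalised discriminant, a quartic polynomial in \<open>r\<close>, is negative. Its nonpositivity cuts out
  an interval around \<open>0\<close> for every \<open>w\<close>, and this gives the closed cylinder.

  Normal lines are cevians, so positive charges exist iff the point of concurrency \<open>\<xi>\<close> lies inside the
  triangle. The product of the three signed areas at \<open>\<xi>\<close> with the area of the triangle is a positive
  multiple of \<open>(1 - r\<^sup>2) L\<^sup>2\<close>, where \<open>L\<close> is affine in \<open>r\<close> and \<open>1 - |\<xi>|\<^sup>2\<close> is \<open>L\<close> times a factor that
  is positive for \<open>r > -1\<close>. The condition becomes \<open>-1 < r < 1\<close> and \<open>L > 0\<close>, an open interval depending
  continuously on \<open>w\<close>.\<close>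

section \<open>Triples on the unit circle\<close>

lemma unit_cnj: "cmod z = 1 \<Longrightarrow> z * cnj z = 1"
  by (metis complex_norm_square of_real_1 power_one)

text \<open>The discriminant of \<open>t\<^sup>3 - r w t\<^sup>2 + r t - w\<close> divided by \<open>w\<^sup>2\<close>, which is real for \<open>|w| = 1\<close>.\<close>

definition triple_disc :: "complex \<Rightarrow> real \<Rightarrow> real" where
  "triple_disc w r = r^4 - 8 * r^3 * Re (w^2) + 18 * r^2 - 27"

text \<open>This is the classical discriminant of a cubic with elementary symmetric functions
  \<open>r * w\<close>, \<open>r\<close>, \<open>w\<close>. Since \<open>w * cnj w = 1\<close>, the
  terms \<open>- 4 * r^3\<close> and \<open>- 4 * r^3 * w^4\<close> combine to
  \<open>- 8 * r^3 * Re (w^2) * w^2\<close>, and \<open>w^2\<close> splits off.\<close>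

lemma triple_disc_eq_roots:
  fixes w x y z :: complex and r :: real
  assumes w: "cmod w = 1"
    and e: "x + y + z = r * w" "x * y + y * z + z * x = r" "x * y * z = w"
  shows "triple_disc w r * w^2 = ((x - y) * (y - z) * (z - x))^2"
proof -
  have c: "w * cnj w = 1" using w by (rule unit_cnj)
  have re: "complex_of_real (Re (w^2)) = (w^2 + cnj w^2) / 2"
    by (metis complex_add_cnj complex_cnj_power nonzero_mult_div_cancel_left of_real_mult
        of_real_numeral zero_neq_numeral)
  have "((x - y) * (y - z) * (z - x))^2 =
     (x + y + z)^2 * (x * y + y * z + z * x)^2 - 4 * (x * y + y * z + z * x)^3
     - 4 * (x + y + z)^3 * (x * y * z) + 18 * (x + y + z) * (x * y + y * z + z * x) * (x * y * z)
     - 27 * (x * y * z)^2"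
    by algebra
  also have "\<dots> = (r * w)^2 * of_real r^2 - 4 * of_real r^3 - 4 * (r * w)^3 * w + 18 * (r * w) * r
      * w - 27 * w^2"
    unfolding e ..
  also have "\<dots> = (of_real r^4 - 8 * of_real r^3 * ((w^2 + cnj w^2) / 2) + 18 * of_real r^2 - 27) * w^2"
    using c by algebra
  also have "\<dots> = triple_disc w r * w^2"
    unfolding triple_disc_def re[symmetric] by simp
  finally show ?thesis ..
qed

text \<open>Conjugation inverts unit numbers, so \<open>cnj (x - y)\<close> is
  \<open>- (x - y) / (x * y)\<close>.\<close>

lemma unit_diff_square:
  fixes x y :: complex
  assumes "cmod x = 1" "cmod y = 1"
  shows "(x - y)^2 = - (x * y) * of_real ((cmod (x - y))^2)"
proof -
  have "complex_of_real ((cmod (x - y))^2) = (x - y) * (cnj x - cnj y)"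
    by (metis complex_cnj_diff complex_norm_square)
  then show ?thesis
    using unit_cnj[OF assms(1)] unit_cnj[OF assms(2)] by algebra
qed

text \<open>Multiplying the three instances of \<open>unit_diff_square\<close> gives the factor
  \<open>- w^2\<close>. For unit roots the normalised discriminant is thus negative exactly when the
  roots are distinct.\<close>

lemma triple_disc_eq_dist:
  fixes w x y z :: complex and r :: real
  assumes u: "cmod x = 1" "cmod y = 1" "cmod z = 1"
    and e: "x + y + z = r * w" "x * y + y * z + z * x = r" "x * y * z = w"
  shows "triple_disc w r = - ((cmod (x - y) * cmod (y - z) * cmod (z - x))^2)"
proof -
  have w: "cmod w = 1" using u by (simp add: e(3)[symmetric] norm_mult)
  have "triple_disc w r * w^2 = (x - y)^2 * (y - z)^2 * (z - x)^2"
    using triple_disc_eq_roots[OF w e] by (simp add: power_mult_distrib)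
  also have "\<dots> = of_real (- ((cmod (x - y) * cmod (y - z) * cmod (z - x))^2)) * w^2"
    unfolding unit_diff_square[OF u(1,2)] unit_diff_square[OF u(2,3)] unit_diff_square[OF u(3,1)]
    by (simp add: e(3)[symmetric] power_mult_distrib power2_eq_square)
  finally show ?thesis
    using w by (metis mult_right_cancel norm_zero of_real_eq_iff power_not_zero zero_neq_one)
qed

text \<open>If \<open>y = 1 / cnj x\<close>, the third root \<open>z\<close> is forced onto the
  circle. Up to powers of \<open>cnj x\<close>, the difference of the pair is the real number
  \<open>|x|^2 - 1\<close>, and the other two differences multiply to \<open>z * |z - x|^2\<close>.
  The sign is therefore opposite to that for three unit roots.\<close>

lemma triple_disc_pos_if_reflected_pair:
  fixes w x y z :: complex and r :: real
  assumes w: "cmod w = 1" and x: "cmod x \<noteq> 1" and xy: "y * cnj x = 1"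
    and e: "x + y + z = r * w" "x * y + y * z + z * x = r" "x * y * z = w"
  shows "0 < triple_disc w r"
proof -
  have nxy: "cmod (x * y) = 1"
    using arg_cong[OF xy, of cmod] by (simp add: norm_mult mult.commute)
  have z: "cmod z = 1"
    using w nxy by (simp add: e(3)[symmetric] norm_mult)
  have zc: "z * cnj z = 1" using z by (rule unit_cnj)
  define m where "m = x * cnj x"
  define k where "k = (z - x) * (cnj z - cnj x)"
  have m: "m = of_real ((cmod x)^2)" unfolding m_def by (simp only: complex_norm_square)
  have k: "k = of_real ((cmod (z - x))^2)"
    unfolding k_def by (metis complex_cnj_diff complex_norm_square)
  have "(x - y) * cnj x = m - 1" unfolding m_def using xy by algebra
  moreover have "(y - z) * (z - x) * cnj x = z * k" unfolding k_def using xy zc by algebra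
  ultimately have 1: "((x - y) * (y - z) * (z - x))^2 * (cnj x)^4 = (m - 1)^2 * z^2 * k^2"
    by algebra
  have "w * cnj x = x * z * (y * cnj x)" unfolding e(3)[symmetric] by (simp only: mult_ac)
  then have "w * cnj x = z * x" unfolding xy by simp
  then have "w^2 * (cnj x)^2 = z^2 * x^2" by algebra
  with 1 triple_disc_eq_roots[OF w e] have "triple_disc w r * (z^2 * x^2) * (cnj x)^2 = (m - 1)^2
      * z^2 * k^2"
    by algebra
  then have "triple_disc w r * m^2 * z^2 = (m - 1)^2 * k^2 * z^2"
    unfolding m_def by algebra
  then have "triple_disc w r * m^2 = (m - 1)^2 * k^2"
    using z by auto
  then have "complex_of_real (triple_disc w r * ((cmod x)^2)^2) = of_real (((cmod x)^2 - 1)^2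
      * ((cmod (z - x))^2)^2)"
    unfolding m k by simp
  then have 2: "triple_disc w r * ((cmod x)^2)^2 = ((cmod x)^2 - 1)^2 * ((cmod (z - x))^2)^2"
    by (simp only: of_real_eq_iff)
  have "(cmod x)^2 \<noteq> 1" using x by (simp add: power2_eq_1_iff) (metis norm_ge_zero not_one_le_zero
      neg_0_le_iff_le)
  moreover have "z \<noteq> x" using x z by auto
  ultimately have "0 < triple_disc w r * ((cmod x)^2)^2" unfolding 2 by simp
  then show ?thesis by (simp add: zero_less_mult_iff)
qed

section \<open>Cubics with all roots on the circle\<close>

lemma cubic_roots:
  fixes p q s :: complex
  obtains x y z :: complex where "x + y + z = p" "x * y + y * z + z * x = q" "x * y * z = s"
proof -
  have "\<not> constant (poly [:- s, q, - p, 1:])"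
    by (subst constant_degree) simp
  then obtain x where "poly [:- s, q, - p, 1:] x = 0"
    using fundamental_theorem_of_algebra by blast
  then have x: "x^3 - p * x^2 + q * x - s = 0"
    by (simp add: algebra_simps power2_eq_square power3_eq_cube)
  \<comment> \<open>Division of the cubic by \<open>t - x\<close> leaves
    \<open>t^2 + b * t + c\<close>, which the quadratic formula solves.\<close>
  define b where "b = x - p"
  define c where "c = x^2 - p * x + q"
  define d where "d = csqrt (b^2 - 4 * c)"
  have d: "d^2 = b^2 - 4 * c" unfolding d_def by simp
  show thesis
  proof
    show "x + (- b + d) / 2 + (- b - d) / 2 = p"
      unfolding b_def by (simp add: field_simps)
    have p: "(- b + d) / 2 * ((- b - d) / 2) = c"
      using d by (simp add: field_simps power2_eq_square)
    have "x * ((- b + d) / 2) + (- b + d) / 2 * ((- b - d) / 2) + (- b - d) / 2 * x = c - b * x"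
      unfolding p by (simp add: field_simps)
    also have "\<dots> = q" unfolding b_def c_def by (simp add: algebra_simps power2_eq_square)
    finally show "x * ((- b + d) / 2) + (- b + d) / 2 * ((- b - d) / 2) + (- b - d) / 2 * x = q" .
    have "x * ((- b + d) / 2) * ((- b - d) / 2) = x * c" using p by (metis mult.assoc)
    also have "\<dots> = s" unfolding c_def using x by algebra
    finally show "x * ((- b + d) / 2) * ((- b - d) / 2) = s" .
  qed
qed

text \<open>The roots are invariant under \<open>t \<mapsto> 1 / cnj t\<close>, so a root off the circle belongs to a reflected pair.\<close>

lemma unit_roots_if_triple_disc_nonpos:
  fixes w :: complex and r :: real
  assumes w: "cmod w = 1" and d: "triple_disc w r \<le> 0"
  obtains x y z :: complex where "cmod x = 1" "cmod y = 1" "cmod z = 1"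
    "x + y + z = r * w" "x * y + y * z + z * x = r" "x * y * z = w"
proof -
  obtain x y z :: complex where e: "x + y + z = r * w" "x * y + y * z + z * x = r" "x * y * z = w"
    by (rule cubic_roots)
  have wc: "w * cnj w = 1" using w by (rule unit_cnj)
  have w0: "w \<noteq> 0" using w by auto
  have f: "(t - x) * (t - y) * (t - z) = t^3 - r * w * t^2 + r * t - w" for t :: complex
    using e by algebra
  have unit: "cmod s = 1" if s: "s = x \<or> s = y \<or> s = z" for s
  proof (rule ccontr)
    assume n: "cmod s \<noteq> 1"
    have "(s - x) * (s - y) * (s - z) = 0" using s by auto
    then have "s^3 - r * w * s^2 + r * s - w = 0" unfolding f .
    then have "cnj (s^3 - r * w * s^2 + r * s - w) = 0" by simp
    then have c0: "cnj s^3 - r * cnj w * cnj s^2 + r * cnj s - cnj w = 0" by simp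
    have s0: "cnj s \<noteq> 0" using s w0 e(3) by auto
    define t where "t = 1 / cnj s"
    have ts: "t * cnj s = 1" using s0 unfolding t_def by simp
    \<comment> \<open>Multiplying the conjugated equation by \<open>t^3\<close> and then by
      \<open>- w\<close> returns the same cubic, now at \<open>t\<close>.\<close>
    have "t^3 - r * w * t^2 + r * t - w = 0"
      using c0 ts wc by algebra
    then have "(t - x) * (t - y) * (t - z) = 0" unfolding f .
    then have t: "t = x \<or> t = y \<or> t = z" by auto
    have "t \<noteq> s"
    proof
      assume "t = s"
      with ts have "complex_of_real ((cmod s)^2) = 1" by (simp only: complex_norm_square)
      then have "(cmod s)^2 = 1" using of_real_eq_1_iff by blast
      then show False using n by (simp add: power2_eq_1_iff) (metis norm_ge_zero not_one_le_zero
          neg_0_le_iff_le)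
    qed
    \<comment> \<open>As \<open>s\<close> and \<open>t\<close> are different roots, they take up two
      of \<open>x\<close>, \<open>y\<close>, \<open>z\<close>; \<open>q\<close> is the remaining
      one.\<close>
    have "\<exists>q. s + t + q = r * w \<and> s * t + t * q + q * s = r \<and> s * t * q = w"
      using s t \<open>t \<noteq> s\<close> e by (auto simp: algebra_simps intro: exI[of _ x] exI[of _ y] exI[of _ z])
    then obtain q where q: "s + t + q = r * w" "s * t + t * q + q * s = r" "s * t * q = w" by blast
    have "0 < triple_disc w r" by (rule triple_disc_pos_if_reflected_pair[OF w n ts q])
    with d show False by simp
  qed
  show thesis by (rule that[of x y z]) (use unit e in auto)
qed

section \<open>Normal lines and their point of concurrency\<close>

text \<open>For the ellipse with squared semi-axes \<open>A\<close> and \<open>B\<close>, in coordinates scaled to the unit circle: the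
  scalar product of \<open>\<xi> - z\<close> with the tangent vector at \<open>z\<close>.\<close>

definition normal_form :: "real \<Rightarrow> real \<Rightarrow> complex \<Rightarrow> complex \<Rightarrow> real" where
  "normal_form A B \<xi> z = B * (Im \<xi> - Im z) * Re z - A * (Re \<xi> - Re z) * Im z"

text \<open>For a unit \<open>z\<close> the real and imaginary parts are combinations of
  \<open>z\<close> and \<open>1 / z\<close>. The terms linear in them yield \<open>z^3\<close> and
  \<open>z\<close> after clearing denominators, the mixed term \<open>C * Re z * Im z\<close> yields
  \<open>z^4\<close> and the constant, and no \<open>z^2\<close> arises.\<close>

lemma normal_form_quartic:
  fixes z g :: complex and C :: real
  assumes z: "cmod z = 1" and g: "g = 2 * Complex (A * Re \<xi>) (- (B * Im \<xi>))" and C: "C = A - B"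
  shows "4 * \<i> * z^2 * normal_form A B \<xi> z = C * z^4 - g * z^3 + cnj g * z - C"
proof -
  define P Q where "P = complex_of_real (A * Re \<xi>)" and "Q = complex_of_real (B * Im \<xi>)"
  define x y where "x = complex_of_real (Re z)" and "y = complex_of_real (Im z)"
  have g: "g = 2 * (P - \<i> * Q)" "cnj g = 2 * (P + \<i> * Q)"
    unfolding g P_def Q_def by (simp_all add: complex_eq_iff)
  have n: "complex_of_real (normal_form A B \<xi> z) = Q * x - P * y + C * x * y"
    unfolding normal_form_def P_def Q_def x_def y_def C by (simp add: algebra_simps)
  have z': "z = x + \<i> * y" unfolding x_def y_def by (rule complex_eq)
  have u: "x^2 + y^2 = 1"
    unfolding x_def y_def using z by (metis cmod_power2 of_real_1 of_real_add of_real_power power_one)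
  have i: "\<i>^2 = -1" by simp
  define j where "j = \<i>"
  have g2: "g = 2 * (P - j * Q)" "cnj g = 2 * (P + j * Q)" unfolding j_def by (fact g)+
  have z2: "z = x + j * y" and j: "j^2 = -1" unfolding j_def by (fact z', fact i)
  show ?thesis unfolding n g2(2) unfolding g2(1) j_def[symmetric] using u j z2 by algebra
qed

text \<open>Vieta's relations for the quartic, whose fourth root is
  \<open>(g - C * (x + y + z)) / C\<close>: the four roots have product -1, and their second
  elementary symmetric function vanishes.\<close>

lemma quartic_roots:
  fixes x y z g g' C :: complex
  assumes d: "x \<noteq> y" "y \<noteq> z" "z \<noteq> x" and C: "C \<noteq> 0"
    and r: "C * x^4 - g * x^3 + g' * x - C = 0" "C * y^4 - g * y^3 + g' * y - C = 0"
      "C * z^4 - g * z^3 + g' * z - C = 0"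
  shows "(g - C * (x + y + z)) * (x * y * z) = - C"
    and "C * (x * y + y * z + z * x) = - ((g - C * (x + y + z)) * (x + y + z))"
proof -
  \<comment> \<open>Divided differences: the first ones eliminate the constant term, the second one
    eliminates \<open>g'\<close>.\<close>
  have 1: "C * (x^3 + x^2 * y + x * y^2 + y^3) - g * (x^2 + x * y + y^2) + g' = 0"
    using r(1,2) d(1) by algebra
  have 2: "C * (y^3 + y^2 * z + y * z^2 + z^3) - g * (y^2 + y * z + z^2) + g' = 0"
    using r(2,3) d(2) by algebra
  have "(z - x) * (C * (x^2 + y^2 + z^2 + x * y + y * z + z * x) - g * (x + y + z)) = 0"
    using 1 2 by algebra
  then have h: "C * (x^2 + y^2 + z^2 + x * y + y * z + z * x) - g * (x + y + z) = 0"
    using d(3) by simp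
  then show s: "C * (x * y + y * z + z * x) = - ((g - C * (x + y + z)) * (x + y + z))"
    by algebra
  define D where "D = g - C * (x + y + z)"
  \<comment> \<open>The remainder of the quartic modulo the cubic with roots \<open>x\<close>,
    \<open>y\<close>, \<open>z\<close> is linear, its quadratic coefficient being zero by
    \<open>h\<close>. Vanishing at two distinct points, it is zero.\<close>
  have l: "(g' + D * (x * y + y * z + z * x) + C * (x * y * z)) * t = C + D * (x * y * z)"
    if "C * t^4 - g * t^3 + g' * t - C = 0" "(t - x) * (t - y) * (t - z) = 0" for t :: complex
    using that h unfolding D_def by algebra
  have "(g' + D * (x * y + y * z + z * x) + C * (x * y * z)) * (x - y) = 0"
    using l[OF r(1)] l[OF r(2)] by (simp add: right_diff_distrib)
  then have "g' + D * (x * y + y * z + z * x) + C * (x * y * z) = 0"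
    using d(1) by simp
  then have "C + D * (x * y * z) = 0"
    using l[OF r(1)] by simp
  then show "(g - C * (x + y + z)) * (x * y * z) = - C"
    unfolding D_def by algebra
qed

lemma unit_elementary:
  fixes x y z :: complex
  assumes u: "cmod x = 1" "cmod y = 1" "cmod z = 1"
  shows "x * y + y * z + z * x = x * y * z * cnj (x + y + z)"
  using unit_cnj[OF u(1)] unit_cnj[OF u(2)] unit_cnj[OF u(3)]
  unfolding complex_cnj_add by algebra

text \<open>Conjugating \<open>unit_elementary\<close> expresses the sum through the conjugate of
  the second symmetric function, which here equals that function.\<close>

lemma unit_elementary_real:
  fixes x y z :: complex
  assumes u: "cmod x = 1" "cmod y = 1" "cmod z = 1"
    and i: "Im (x * y + y * z + z * x) = 0"
  shows "x * y + y * z + z * x = Re (x * y + y * z + z * x)"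
    and "x + y + z = Re (x * y + y * z + z * x) * (x * y * z)"
proof -
  show r: "x * y + y * z + z * x = Re (x * y + y * z + z * x)"
    using i by (simp add: complex_eq_iff)
  have "cmod (x * y * z) = 1" using u by (simp add: norm_mult)
  then have "x * y * z * cnj (x * y * z) = 1" by (rule unit_cnj)
  moreover have "cnj (x * y + y * z + z * x) = cnj (x * y * z) * (x + y + z)"
    by (subst unit_elementary[OF u]) simp
  moreover have "cnj (x * y + y * z + z * x) = x * y + y * z + z * x"
    using i by (simp add: complex_eq_iff)
  ultimately have "x + y + z = (x * y + y * z + z * x) * (x * y * z)" by algebra
  then show "x + y + z = Re (x * y + y * z + z * x) * (x * y * z)" by (subst (asm) r)
qed

text \<open>Three common zeros leave \<open>- cnj w\<close> as the fourth root of the quartic.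
  Vieta's vanishing quadratic coefficient then says that \<open>x * y + y * z + z * x\<close> equals
  its own conjugate. Conversely, for real \<open>r\<close> the quartic is
  \<open>C * (t^3 - r * w * t^2 + r * t - w) * (t + cnj w)\<close>. The remaining equations compare
  \<open>g\<close> and locate \<xi>.\<close>

lemma concurrent_iff:
  fixes x y z \<xi> :: complex
  assumes u: "cmod x = 1" "cmod y = 1" "cmod z = 1"
    and d: "x \<noteq> y" "y \<noteq> z" "z \<noteq> x" and C: "C = A - B" "C \<noteq> 0"
  defines "w \<equiv> x * y * z" and "r \<equiv> Re (x * y + y * z + z * x)"
  shows "normal_form A B \<xi> x = 0 \<and> normal_form A B \<xi> y = 0 \<and> normal_form A B \<xi> z = 0 \<longleftrightarrow>
    Im (x * y + y * z + z * x) = 0 \<and>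
    2 * A * Re \<xi> = C * (r - 1) * Re w \<and> 2 * B * Im \<xi> = - (C * (r + 1) * Im w)"
proof -
  define g where "g = 2 * Complex (A * Re \<xi>) (- (B * Im \<xi>))"
  have w: "w * cnj w = 1" unfolding w_def using u by (intro unit_cnj) (simp add: norm_mult)
  have n: "normal_form A B \<xi> t = 0 \<longleftrightarrow> C * t^4 - g * t^3 + cnj g * t - C = 0" if "cmod t = 1" for t :: complex
  proof -
    have "4 * \<i> * t^2 \<noteq> 0" using that by auto
    then show ?thesis
      using normal_form_quartic[OF that g_def C(1)] by (metis mult_eq_0_iff of_real_eq_0_iff)
  qed
  have g_iff: "g = C * (of_real r * w - cnj w) \<longleftrightarrow>
      2 * A * Re \<xi> = C * (r - 1) * Re w \<and> 2 * B * Im \<xi> = - (C * (r + 1) * Im w)"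
    unfolding g_def by (auto simp: complex_eq_iff algebra_simps)
  show ?thesis unfolding g_iff[symmetric]
  proof
    assume "normal_form A B \<xi> x = 0 \<and> normal_form A B \<xi> y = 0 \<and> normal_form A B \<xi> z = 0"
    then have h: "C * x^4 - g * x^3 + cnj g * x - C = 0" "C * y^4 - g * y^3 + cnj g * y - C = 0"
      "C * z^4 - g * z^3 + cnj g * z - C = 0"
      using n u by auto
    have C': "complex_of_real C \<noteq> 0" using C by simp
    note q = quartic_roots[OF d C' h]
    have g: "g - C * (x + y + z) = - (C * cnj w)"
      using q(1) w unfolding w_def[symmetric] by algebra
    have "C * (x * y + y * z + z * x) = C * (cnj w * (x + y + z))"
      using q(2) unfolding g by simp
    then have "x * y + y * z + z * x = cnj w * (x + y + z)" using C' by simp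
    also have "\<dots> = cnj (x * y + y * z + z * x)"
      unfolding unit_elementary[OF u] w_def by simp
    finally have "Im (x * y + y * z + z * x) = Im (cnj (x * y + y * z + z * x))" by (rule arg_cong)
    then have i: "Im (x * y + y * z + z * x) = 0" unfolding cnj.simps by linarith
    have "x + y + z = r * w" unfolding r_def w_def by (rule unit_elementary_real(2)[OF u i])
    then have "g = C * (of_real r * w - cnj w)" using g by algebra
    with i show "Im (x * y + y * z + z * x) = 0 \<and> g = C * (of_real r * w - cnj w)" by blast
  next
    assume h: "Im (x * y + y * z + z * x) = 0 \<and> g = C * (of_real r * w - cnj w)"
    then have g: "g = C * (of_real r * w - cnj w)" "cnj g = C * (of_real r * cnj w - w)" by simp_all
    have e: "x + y + z = r * w" "x * y + y * z + z * x = r"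
      unfolding r_def w_def using unit_elementary_real[OF u] h by blast+
    have "C * t^4 - g * t^3 + cnj g * t - C = 0" if "(t - x) * (t - y) * (t - z) = 0" for t :: complex
    proof -
      have "(t - x) * (t - y) * (t - z) = t^3 - (r * w) * t^2 + r * t - w"
        using e w_def by algebra
      then show ?thesis unfolding g(2) unfolding g(1) using that w by algebra
    qed
    then show "normal_form A B \<xi> x = 0 \<and> normal_form A B \<xi> y = 0 \<and> normal_form A B \<xi> z = 0"
      using n u by auto
  qed
qed

section \<open>Signed areas and the position of the point of concurrency\<close>

text \<open>Twice the signed area of the triangle with vertices \<open>\<xi>\<close>, \<open>x\<close>, \<open>y\<close>.\<close>

definition signed_area :: "complex \<Rightarrow> complex \<Rightarrow> complex \<Rightarrow> real" where
  "signed_area \<xi> x y = Im (cnj (x - \<xi>) * (y - \<xi>))"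

text \<open>The factor shared by the products in \<open>product_lines\<close> and \<open>norm_center\<close>.\<close>

definition balance_form :: "real \<Rightarrow> real \<Rightarrow> complex \<Rightarrow> real \<Rightarrow> real" where
  "balance_form A B w r = B^2 * (Re w)^2 * (3 * A - B - (A - B) * r)
    + A^2 * (Im w)^2 * (3 * B - A - (A - B) * r)"

text \<open>The last factor is the equation of the chord through \<open>x\<close> and
  \<open>y\<close>, evaluated at \<xi>.\<close>

lemma signed_area_eq:
  fixes x y \<xi> :: complex
  assumes "cmod x = 1" "cmod y = 1"
  shows "2 * \<i> * (x * y) * signed_area \<xi> x y = (y - x) * (x + y - \<xi> - x * y * cnj \<xi>)"
proof -
  have h: "2 * \<i> * complex_of_real (Im q) = q - cnj q" for q by (simp add: complex_eq_iff)
  have "2 * \<i> * complex_of_real (signed_area \<xi> x y) =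
      (cnj x - cnj \<xi>) * (y - \<xi>) - (x - \<xi>) * (cnj y - cnj \<xi>)"
    unfolding signed_area_def h by simp
  then show ?thesis
    using unit_cnj[OF assms(1)] unit_cnj[OF assms(2)] by algebra
qed

text \<open>The sum is twice the signed area of the triangle itself, hence independent of
  \<xi>.\<close>

lemma signed_area_sum:
  fixes x y z \<xi> :: complex
  assumes "cmod x = 1" "cmod y = 1" "cmod z = 1"
  shows "2 * \<i> * (x * y * z) * (signed_area \<xi> x y + signed_area \<xi> y z + signed_area \<xi> z x)
    = (y - x) * (z - y) * (x - z)"
  using signed_area_eq[OF assms(1,2), of \<xi>] signed_area_eq[OF assms(2,3), of \<xi>]
    signed_area_eq[OF assms(3,1), of \<xi>]
  unfolding of_real_add by algebra

text \<open>The product of the three chord equations is symmetric in the vertices, so it depends on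
  \<open>r\<close>, \<open>w\<close> and \<xi> only, and \<xi> is itself determined by
  \<open>r\<close> and \<open>w\<close>.\<close>

lemma product_lines:
  fixes x y z w \<xi> :: complex and A B r :: real
  assumes u: "cmod x = 1" "cmod y = 1" "cmod z = 1"
    and w: "w = x * y * z"
    and e: "x + y + z = r * w" "x * y + y * z + z * x = r"
    and A: "A > 0" and B: "B > 0"
    and xi: "2 * A * Re \<xi> = (A - B) * (r - 1) * Re w" "2 * B * Im \<xi> = - ((A - B) * (r + 1) * Im w)"
  shows "4 * (A * B)^3 * ((x + y - \<xi> - x * y * cnj \<xi>) * (y + z - \<xi> - y * z * cnj \<xi>) * (z + x - \<xi> - z
      * x * cnj \<xi>))
     = w * ((r^2 - 1) * (balance_form A B w r)^2)"
proof -
  define V where "V = cnj w"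
  have wV: "w * V = 1" unfolding V_def w using u by (intro unit_cnj) (simp add: norm_mult)
  define m n where "m = complex_of_real (B * (r - 1) - A * (r + 1))"
    and "n = complex_of_real (B * (r - 1) + A * (r + 1))"
  define C where "C = complex_of_real (A - B)"
  define K where "K = complex_of_real (4 * A * B)"
  \<comment> \<open>The two coordinate equations for \<xi> as one complex equation; \<open>K\<close>
    clears the denominators \<open>2 * A\<close> and \<open>2 * B\<close>.\<close>
  have X: "K * \<xi> = C * (m * w + n * V)"
  proof (rule complex_eqI)
    have "4 * A * B * Re \<xi> = 2 * B * ((A - B) * (r - 1) * Re w)" using xi(1) by algebra
    then show "Re (K * \<xi>) = Re (C * (m * w + n * V))"
      unfolding K_def C_def m_def n_def V_def by (simp add: algebra_simps)
    have "4 * A * B * Im \<xi> = 2 * A * (- ((A - B) * (r + 1) * Im w))" using xi(2) by algebra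
    then show "Im (K * \<xi>) = Im (C * (m * w + n * V))"
      unfolding K_def C_def m_def n_def V_def by (simp add: algebra_simps)
  qed
  have Y: "K * cnj \<xi> = C * (m * V + n * w)"
    using arg_cong[OF X, of cnj] unfolding K_def C_def m_def n_def V_def by simp
  \<comment> \<open>Expansion of the product in elementary symmetric functions, with
    \<open>X\<close> and \<open>Y\<close> still free.\<close>
  have sym: "(K * (x + y) - X - x * y * Y) * (K * (y + z) - X - y * z * Y) * (K * (z + x) - X - z * x * Y)
     = K^3 * (a * b - c) - K^2 * X * (a^2 + b) - K^2 * Y * (b^2 + a * c)
       + 2 * K * X^2 * a + K * X * Y * (a * b + 3 * c) + 2 * K * Y^2 * b * c
       - X^3 - X^2 * Y * b - X * Y^2 * a * c - Y^3 * c^2"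
    if "a = x + y + z" "b = x * y + y * z + z * x" "c = x * y * z" for X Y a b c :: complex
    unfolding that by algebra
  define P where "P = (x + y - \<xi> - x * y * cnj \<xi>) * (y + z - \<xi> - y * z * cnj \<xi>) * (z + x - \<xi> - z * x
      * cnj \<xi>)"
  define R where "R = complex_of_real r"
  have l: "4 * complex_of_real (balance_form A B w r) = of_real B^2 * (w + V)^2 * (3 * of_real A
      - of_real B - C * R)
     - of_real A^2 * (w - V)^2 * (3 * of_real B - of_real A - C * R)"
  proof -
    define a b j where "a = complex_of_real (Re w)" and "b = complex_of_real (Im w)" and "j = \<i>"
    have "w + V = 2 * a" "w - V = 2 * j * b" "j^2 = -1"
      unfolding V_def a_def b_def j_def by (simp_all add: complex_eq_iff)
    moreover have "complex_of_real (balance_form A B w r) = of_real B^2 * a^2 * (3 * of_real A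
        - of_real B - C * R)
      + of_real A^2 * b^2 * (3 * of_real B - of_real A - C * R)"
      unfolding balance_form_def C_def R_def a_def b_def by simp
    ultimately show ?thesis by algebra
  qed
  have "K^3 * P = (K * (x + y) - K * \<xi> - x * y * (K * cnj \<xi>)) * (K * (y + z) - K * \<xi> - y * z * (K * cnj \<xi>))
      * (K * (z + x) - K * \<xi> - z * x * (K * cnj \<xi>))"
    unfolding P_def by algebra
  also have "\<dots> = w * (R^2 - 1) * (4 * complex_of_real (balance_form A B w r))^2"
  proof -
    define A' B' where "A' = complex_of_real A" and "B' = complex_of_real B"
    have defs: "K = 4 * A' * B'" "C = A' - B'" "m = B' * (R - 1) - A' * (R + 1)" "n = B' * (R - 1)
        + A' * (R + 1)"
      unfolding K_def C_def m_def n_def A'_def B'_def R_def by simp_all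
    show ?thesis
    unfolding X Y sym[OF e[symmetric] w] l A'_def[symmetric] B'_def[symmetric]
    unfolding R_def[symmetric] defs using wV by algebra
  qed
  finally have "K^3 * P = w * (R^2 - 1) * (4 * complex_of_real (balance_form A B w r))^2" .
  then show ?thesis unfolding P_def[symmetric] K_def R_def
    by (simp add: power_mult_distrib mult_ac)
qed

text \<open>After inserting \<open>(Re w)^2 + (Im w)^2 = 1\<close>, the coefficients of
  \<open>(Re w)^2\<close> and \<open>(Im w)^2\<close> are differences of squares. Both contain the
  factor \<open>(A - B) * r + A + B\<close>; the cofactors make up
  \<open>balance_form\<close>.\<close>

lemma norm_center:
  fixes w \<xi> :: complex and A B r :: real
  assumes w: "cmod w = 1"
    and xi: "2 * A * Re \<xi> = (A - B) * (r - 1) * Re w" "2 * B * Im \<xi> = - ((A - B) * (r + 1) * Im w)"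
  shows "4 * A^2 * B^2 * (1 - (cmod \<xi>)^2) = ((A - B) * r + A + B) * balance_form A B w r"
proof -
  have "(Re w)^2 + (Im w)^2 = 1" using w by (metis cmod_power2 power_one)
  then show ?thesis using xi unfolding balance_form_def cmod_power2 by algebra
qed

lemma signed_area_barycentric:
  fixes x y z \<xi> :: complex
  shows
  "(signed_area \<xi> x y + signed_area \<xi> y z + signed_area \<xi> z x) * \<xi> = signed_area \<xi> y z * x
      + signed_area \<xi> z x * y + signed_area \<xi> x y * z"
  unfolding signed_area_def by (simp add: complex_eq_iff algebra_simps)

text \<open>The power of a point with respect to the circumcircle in barycentric coordinates. It
  shows that a point inside the triangle lies inside the disk.\<close>

lemma signed_area_norm:
  fixes x y z \<xi> :: complex
  assumes "cmod x = 1" "cmod y = 1" "cmod z = 1"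
  shows "(signed_area \<xi> x y + signed_area \<xi> y z + signed_area \<xi> z x)^2 * (1 - (cmod \<xi>)^2) =
    signed_area \<xi> y z * signed_area \<xi> z x * (cmod (x - y))^2 + signed_area \<xi> z x * signed_area \<xi> x y
        * (cmod (y - z))^2
    + signed_area \<xi> x y * signed_area \<xi> y z * (cmod (z - x))^2"
proof -
  define a b c where "a = signed_area \<xi> x y" "b = signed_area \<xi> y z" "c = signed_area \<xi> z x"
  have "(Re x)^2 + (Im x)^2 = 1" "(Re y)^2 + (Im y)^2 = 1" "(Re z)^2 + (Im z)^2 = 1"
    using assms by (metis cmod_power2 power_one)+
  moreover have "(a + b + c) * Re \<xi> = b * Re x + c * Re y + a * Re z"
    "(a + b + c) * Im \<xi> = b * Im x + c * Im y + a * Im z"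
    using signed_area_barycentric[of \<xi> x y z] unfolding a_b_c_def by (simp_all add: complex_eq_iff)
  ultimately show ?thesis
    unfolding a_b_c_def[symmetric] cmod_power2 minus_complex.simps by algebra
qed

text \<open>The three areas and their sum each bring in differences of vertices; together these form
  the discriminant, while the chord equations are handled by \<open>product_lines\<close>. The
  constant 64 is \<open>(2 * \<i>)^4 = 16\<close> times the 4 from there.\<close>

lemma signed_area_product:
  fixes x y z w \<xi> :: complex and A B r :: real
  assumes u: "cmod x = 1" "cmod y = 1" "cmod z = 1"
    and w: "w = x * y * z"
    and e: "x + y + z = r * w" "x * y + y * z + z * x = r"
    and A: "A > 0" and B: "B > 0"
    and xi: "2 * A * Re \<xi> = (A - B) * (r - 1) * Re w" "2 * B * Im \<xi> = - ((A - B) * (r + 1) * Im w)"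
  shows "64 * (A * B)^3 * (signed_area \<xi> x y * signed_area \<xi> y z * signed_area \<xi> z x
      * (signed_area \<xi> x y + signed_area \<xi> y z + signed_area \<xi> z x))
    = triple_disc w r * ((r^2 - 1) * (balance_form A B w r)^2)"
proof -
  define a b c where "a = complex_of_real (signed_area \<xi> x y)" "b = complex_of_real (signed_area \<xi> y z)"
    "c = complex_of_real (signed_area \<xi> z x)"
  define i where "i = 2 * \<i>"
  define f g h where "f = x + y - \<xi> - x * y * cnj \<xi>" "g = y + z - \<xi> - y * z * cnj \<xi>"
    "h = z + x - \<xi> - z * x * cnj \<xi>"
  have nw: "cmod w = 1" using u w by (simp add: norm_mult)
  have 1: "i * (x * y) * a = (y - x) * f" "i * (y * z) * b = (z - y) * g" "i * (z * x) * c = (x - z) * h"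
    unfolding i_def a_b_c_def f_g_h_def using signed_area_eq[OF u(1,2)] signed_area_eq[OF u(2,3)]
        signed_area_eq[OF u(3,1)]
    by auto
  have 2: "i * (x * y * z) * (a + b + c) = (y - x) * (z - y) * (x - z)"
    unfolding i_def a_b_c_def using signed_area_sum[OF u] by simp
  have 3: "triple_disc w r * w^2 = ((x - y) * (y - z) * (z - x))^2"
    using triple_disc_eq_roots[OF nw e] w by simp
  have 4: "4 * (A * B)^3 * (f * g * h) = w * ((r^2 - 1) * (balance_form A B w r)^2)"
    unfolding f_g_h_def using product_lines[OF u w e A B xi] by simp
  have "i^4 = 16" unfolding i_def by (simp add: power_mult_distrib)
  have "i^3 * (x * y * z)^2 * (a * b * c) = (i * (x * y) * a) * (i * (y * z) * b) * (i * (z * x) * c)"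
    by algebra
  also have "\<dots> = ((y - x) * (z - y) * (x - z)) * (f * g * h)" unfolding 1 by algebra
  finally have "i^3 * w^2 * (a * b * c) * (i * w * (a + b + c)) = ((x - y) * (y - z) * (z - x))^2
      * (f * g * h)"
    using 2 unfolding w by algebra
  then have "i^4 * w^3 * (a * b * c * (a + b + c)) = triple_disc w r * w^2 * (f * g * h)"
    unfolding 3 by algebra
  then have "16 * w^3 * (a * b * c * (a + b + c)) = triple_disc w r * w^2 * (f * g * h)"
    unfolding \<open>i^4 = 16\<close> .
  moreover have "complex_of_real (64 * (A * B)^3) = 16 * of_real (4 * (A * B)^3)" by simp
  ultimately have "w^3 * (64 * (A * B)^3 * (a * b * c * (a + b + c))) = triple_disc w r * w^2 * (4
      * (A * B)^3 * (f * g * h))"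
    by algebra
  also have "\<dots> = w^3 * (triple_disc w r * ((r^2 - 1) * (balance_form A B w r)^2))"
    unfolding 4 by (simp add: power2_eq_square power3_eq_cube mult_ac)
  finally have "64 * (A * B)^3 * (a * b * c * (a + b + c)) = triple_disc w r * ((r^2 - 1)
      * (balance_form A B w r)^2)"
    using nw by auto
  then have "complex_of_real (64 * (A * B)^3 * (signed_area \<xi> x y * signed_area \<xi> y z
      * signed_area \<xi> z x * (signed_area \<xi> x y + signed_area \<xi> y z + signed_area \<xi> z x)))
    = complex_of_real (triple_disc w r * ((r^2 - 1) * (balance_form A B w r)^2))"
    unfolding a_b_c_def by simp
  then show ?thesis by (simp only: of_real_eq_iff)
qed

text \<open>A point with exactly one positive barycentric coordinate lies outside the open disk.\<close>

lemma barycentric_signs: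
  fixes x y z \<xi> :: complex and p q s :: real
  assumes u: "cmod x = 1" "cmod y = 1" "cmod z = 1" and "cmod \<xi> < 1"
    and b: "(p + q + s) * \<xi> = p * x + q * y + s * z"
    and pos: "0 < p * q * s * (p + q + s)"
  shows "0 < p * q \<and> 0 < q * s \<and> 0 < s * p"
proof -
  have D: "p + q + s \<noteq> 0" using pos by auto
  \<comment> \<open>Triangle inequality for the term \<open>p * x\<close>, strict because \<xi> is
    in the open disk.\<close>
  have *: "\<bar>p\<bar> < \<bar>p + q + s\<bar> + \<bar>q\<bar> + \<bar>s\<bar>"
    if "cmod x = 1" "cmod y = 1" "cmod z = 1" "p + q + s \<noteq> 0"
      and b: "(p + q + s) * \<xi> = p * x + q * y + s * z" for p q s :: real and x y z :: complex
  proof -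
    have "p * x = (p + q + s) * \<xi> - q * y - s * z" using b by algebra
    then have "cmod (p * x) \<le> cmod ((p + q + s) * \<xi>) + cmod (q * y) + cmod (s * z)"
      by (metis add_mono_thms_linordered_semiring(3) norm_triangle_ineq4 order_trans)
    then have "\<bar>p\<bar> \<le> \<bar>p + q + s\<bar> * cmod \<xi> + \<bar>q\<bar> + \<bar>s\<bar>"
      using that(1-3) by (simp only: norm_mult norm_of_real mult_1_right)
    moreover have "\<bar>p + q + s\<bar> * cmod \<xi> < \<bar>p + q + s\<bar> * 1"
      using that(4) assms(4) by (intro mult_strict_left_mono) auto
    ultimately show ?thesis by linarith
  qed
  have "\<bar>p\<bar> < \<bar>p + q + s\<bar> + \<bar>q\<bar> + \<bar>s\<bar>" by (rule *[OF u D b])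
  moreover have "\<bar>q\<bar> < \<bar>q + s + p\<bar> + \<bar>s\<bar> + \<bar>p\<bar>"
    by (rule *[OF u(2,3,1)]) (use D b in \<open>auto simp: algebra_simps\<close>)
  moreover have "\<bar>s\<bar> < \<bar>s + p + q\<bar> + \<bar>p\<bar> + \<bar>q\<bar>"
    by (rule *[OF u(3,1,2)]) (use D b in \<open>auto simp: algebra_simps\<close>)
  \<comment> \<open>A common sign change makes \<open>p + q + s\<close> positive, so the number of
    negative coordinates is even. If only \<open>p\<close> were positive, \<open>|p|\<close> would
    equal \<open>|p + q + s| + |q| + |s|\<close>, which the inequalities exclude.\<close>
  ultimately show ?thesis using pos unfolding zero_less_mult_iff mult_less_0_iff
    by (auto simp: abs_if split: if_splits)
qed

text \<open>As the discriminant is negative, \<open>signed_area_product\<close> turns positivity of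
  the product into \<open>|r| < 1\<close> and \<open>balance_form\<close> nonzero. The sign of
  \<open>balance_form\<close> tells by \<open>norm_center\<close> whether \<xi> is in the disk.
  Interior points are in the disk, and conversely \<open>barycentric_signs\<close> rules out the
  other sign pattern there.\<close>

lemma center_in_triangle_iff:
  fixes x y z w \<xi> :: complex and A B r :: real
  assumes u: "cmod x = 1" "cmod y = 1" "cmod z = 1"
    and d: "x \<noteq> y" "y \<noteq> z" "z \<noteq> x"
    and w: "w = x * y * z"
    and e: "x + y + z = r * w" "x * y + y * z + z * x = r"
    and B: "0 < B" and A: "B < A"
    and xi: "2 * A * Re \<xi> = (A - B) * (r - 1) * Re w" "2 * B * Im \<xi> = - ((A - B) * (r + 1) * Im w)"
  shows "0 < signed_area \<xi> x y * signed_area \<xi> y z \<and> 0 < signed_area \<xi> y z * signed_area \<xi> z x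
      \<and> 0 < signed_area \<xi> z x * signed_area \<xi> x y \<longleftrightarrow>
    -1 < r \<and> r < 1 \<and> 0 < balance_form A B w r"
proof -
  define a b c where abc: "a = signed_area \<xi> x y" "b = signed_area \<xi> y z" "c = signed_area \<xi> z x"
  have A0: "0 < A" using A B by simp
  have pos_scale: "0 < k * t \<longleftrightarrow> 0 < t" if "0 < k" for k t :: real
    using that by (simp add: zero_less_mult_iff)
  have nw: "cmod w = 1" using u w by (simp add: norm_mult)
  have triple_disc: "triple_disc w r < 0"
    using triple_disc_eq_dist[OF u e w[symmetric]] d by simp
  have prod: "64 * (A * B)^3 * (a * b * c * (a + b + c)) = triple_disc w r * ((r^2 - 1)
      * (balance_form A B w r)^2)"
    unfolding abc by (rule signed_area_product[OF u w e A0 B xi])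
  have pos_iff: "0 < a * b * c * (a + b + c) \<longleftrightarrow> r^2 < 1 \<and> balance_form A B w r \<noteq> 0"
  proof -
    have "0 < a * b * c * (a + b + c) \<longleftrightarrow> 0 < 64 * (A * B)^3 * (a * b * c * (a + b + c))"
      using A0 B by (intro pos_scale[symmetric]) simp
    also have "\<dots> \<longleftrightarrow> (r^2 - 1) * (balance_form A B w r)^2 < 0"
      unfolding prod using triple_disc by (simp add: zero_less_mult_iff)
    also have "\<dots> \<longleftrightarrow> r^2 < 1 \<and> balance_form A B w r \<noteq> 0"
      by (auto simp: mult_less_0_iff)
    finally show ?thesis .
  qed
  have r1: "r^2 < 1 \<longleftrightarrow> -1 < r \<and> r < 1"
    by (simp add: abs_square_less_1 abs_less_iff) linarith
  have disk: "0 < 1 - (cmod \<xi>)^2 \<longleftrightarrow> 0 < balance_form A B w r" if r: "-1 < r"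
  proof -
    have "0 < (A - B) * (r + 1)" using A r by simp
    then have "0 < (A - B) * r + A + B" using B by (simp add: algebra_simps)
    moreover have "0 < 1 - (cmod \<xi>)^2 \<longleftrightarrow> 0 < 4 * A^2 * B^2 * (1 - (cmod \<xi>)^2)"
      using A0 B by (intro pos_scale[symmetric]) simp
    ultimately show ?thesis
      unfolding norm_center[OF nw xi] by (simp add: zero_less_mult_iff)
  qed
  show ?thesis unfolding abc[symmetric]
  proof
    assume p: "0 < a * b \<and> 0 < b * c \<and> 0 < c * a"
    then have "0 < a * b * c * (a + b + c)"
      by (auto simp: zero_less_mult_iff mult_less_0_iff)
    then have r: "-1 < r" "r < 1" and n: "balance_form A B w r \<noteq> 0" using pos_iff r1 by auto
    have "0 < (a + b + c)^2 * (1 - (cmod \<xi>)^2)"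
      using signed_area_norm[OF u, of \<xi>] p d unfolding abc[symmetric]
      by (simp add: add_pos_pos mult.commute)
    then have "0 < 1 - (cmod \<xi>)^2" by (simp only: zero_less_mult_iff) auto
    with r disk show "-1 < r \<and> r < 1 \<and> 0 < balance_form A B w r" by blast
  next
    assume h: "-1 < r \<and> r < 1 \<and> 0 < balance_form A B w r"
    then have "0 < a * b * c * (a + b + c)" using pos_iff r1 by auto
    then have pos: "0 < b * c * a * (b + c + a)" by (simp add: mult_ac add_ac)
    have "(cmod \<xi>)^2 < 1^2" using disk h by simp
    then have n: "cmod \<xi> < 1" by (rule power2_less_imp_less) simp
    have "complex_of_real (b + c + a) * \<xi> = b * x + c * y + a * z"
      using signed_area_barycentric[of \<xi> x y z] unfolding abc by (simp add: add_ac)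
    then have "0 < b * c \<and> 0 < c * a \<and> 0 < a * b"
      by (intro barycentric_signs[OF u n _ pos]) simp
    then show "0 < a * b \<and> 0 < b * c \<and> 0 < c * a" by blast
  qed
qed

text \<open>Vanishing of the normal form makes \<open>\<xi> - x\<close> a multiple \<open>t\<close>
  of the normal direction \<open>(B * Re x, A * Im x)\<close>. The area with a third point
  \<open>y\<close> then measures on which side of the normal at \<open>x\<close> that point
  lies.\<close>

lemma signed_area_normal_form:
  assumes x: "cmod x = 1" and A: "0 < A" and B: "0 < B" and n: "normal_form A B \<xi> x = 0"
  obtains t where "\<forall>y. signed_area \<xi> x y = - (t * normal_form A B y x)"
    "\<forall>y. signed_area \<xi> y x = t * normal_form A B y x"
proof -
  define m where "m = (B * Re x)^2 + (A * Im x)^2"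
  have "Re x \<noteq> 0 \<or> Im x \<noteq> 0" using x by (auto simp: cmod_def)
  then have m: "0 < m" unfolding m_def using A B by (auto simp: add_pos_nonneg add_nonneg_pos)
  define t where "t = ((Re \<xi> - Re x) * B * Re x + (Im \<xi> - Im x) * A * Im x) / m"
  have t: "t * m = (Re \<xi> - Re x) * B * Re x + (Im \<xi> - Im x) * A * Im x"
    unfolding t_def using m by simp
  have "m * (Re \<xi> - Re x) = m * (t * (B * Re x))" "m * (Im \<xi> - Im x) = m * (t * (A * Im x))"
    using t n unfolding normal_form_def m_def by algebra+
  then have *: "Re \<xi> - Re x = t * (B * Re x)" "Im \<xi> - Im x = t * (A * Im x)"
    using m by (metis less_irrefl mult_left_cancel)+
  have "signed_area \<xi> x y = - (t * normal_form A B y x)" for y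
  proof -
    have "signed_area \<xi> x y = (Re x - Re \<xi>) * (Im y - Im \<xi>) - (Im x - Im \<xi>) * (Re y - Re \<xi>)"
      unfolding signed_area_def by (simp add: algebra_simps)
    then show ?thesis unfolding normal_form_def using * by algebra
  qed
  moreover have "signed_area \<xi> y x = - signed_area \<xi> x y" for y unfolding signed_area_def
      by (simp add: algebra_simps)
  ultimately show thesis by (intro that[of t]) auto
qed

lemma signed_area_vertex_nonzero:
  assumes "cmod x = 1" "cmod y = 1" "cmod z = 1" "x \<noteq> y" "y \<noteq> z" "z \<noteq> x"
  shows "signed_area \<xi> x y + signed_area \<xi> y z + signed_area \<xi> z x \<noteq> 0"
proof
  assume "signed_area \<xi> x y + signed_area \<xi> y z + signed_area \<xi> z x = 0"
  then have "(y - x) * (z - y) * (x - z) = 0" using signed_area_sum[OF assms(1-3), of \<xi>] by simp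
  then show False using assms(4-6) by simp
qed

text \<open>Otherwise both \<open>y\<close> and \<open>z\<close> would lie on the normal at
  \<open>x\<close>, and three distinct points of a circle would be collinear.\<close>

lemma normal_form_not_both_zero:
  assumes u: "cmod x = 1" "cmod y = 1" "cmod z = 1" and d: "x \<noteq> y" "y \<noteq> z" "z \<noteq> x"
    and A: "0 < A" and B: "0 < B"
  shows "\<not> (normal_form A B y x = 0 \<and> normal_form A B z x = 0)"
proof
  assume n: "normal_form A B y x = 0 \<and> normal_form A B z x = 0"
  have "signed_area x x y = 0" "signed_area x z x = 0" unfolding signed_area_def by simp_all
  then have ne: "signed_area x y z \<noteq> 0" using signed_area_vertex_nonzero[OF u d, of x] by simp
  have "signed_area x y z = (Re y - Re x) * (Im z - Im x) - (Im y - Im x) * (Re z - Re x)"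
    unfolding signed_area_def by (simp add: algebra_simps)
  then have "(B * Re x) * signed_area x y z = 0" "(A * Im x) * signed_area x y z = 0"
    using n unfolding normal_form_def by algebra+
  then have "Re x = 0" "Im x = 0" using ne A B by simp_all
  then show False using u(1) by (simp add: cmod_def)
qed

text \<open>To be applied to the tangential balance at a vertex, with the other two charges over
  cubed distances as weights.\<close>

lemma opposite_signs:
  fixes m n k l :: real
  assumes "0 < k" "0 < l" "k * m + l * n = 0" "\<not> (m = 0 \<and> n = 0)"
  shows "m * n < 0"
proof -
  have "k * (m * n) = - (l * n^2)" using assms(3) by algebra
  moreover have "n \<noteq> 0" using assms by auto
  ultimately have "k * (m * n) < 0" using assms(2) by simp
  then show ?thesis using assms(1) by (simp add: mult_less_0_iff)
qed

section \<open>The symmetric cube of a circle\<close>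

lemma continuous_map_sym_cube:
  "continuous_map (sym_cube X) Y f \<longleftrightarrow> continuous_map (cube_topology X) Y (f \<circ> unordered)"
  using continuous_compose_quotient_map_eq[OF quotient_map_unordered] by metis

lemma compact_space_sym_cube:
  assumes "compact_space X"
  shows "compact_space (sym_cube X)"
proof -
  have "compact_space (cube_topology X)"
    using assms by (simp add: compact_space_prod_topology)
  then have "compactin (sym_cube X) (unordered ` topspace (cube_topology X))"
    unfolding compact_space_def
    by (rule image_compactin) (rule quotient_imp_continuous_map[OF quotient_map_unordered])
  then show ?thesis unfolding compact_space_def topspace_sym_cube .
qed

lemma cube_topology_top_of_set: "cube_topology (top_of_set X) = top_of_set (X \<times> X \<times> X)"
  by (simp add: subtopology_Times[symmetric])

text \<open>The hypotheses make two monic cubics equal, so \<open>x\<close> is one of the primed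
  roots. Removing it leaves the same question for quadratics.\<close>

lemma triple_eq_if_elementary_eq:
  fixes x y z x' y' z' :: "'a::idom"
  assumes "x + y + z = x' + y' + z'" "x * y + y * z + z * x = x' * y' + y' * z' + z' * x'"
    "x * y * z = x' * y' * z'"
  shows "{#x, y, z#} = {#x', y', z'#}"
proof -
  have f: "(t - x) * (t - y) * (t - z) = (t - x') * (t - y') * (t - z')" for t
    using assms by algebra
  have two: "{#y, z#} = {#y', z'#}" if "y + z = y' + z'" "y * z = y' * z'" for y z y' z' :: 'a
  proof -
    have "(y - y') * (y - z') = 0" using that by algebra
    then show ?thesis using that(1) by (auto simp: add_mset_commute add.commute)
  qed
  have three: "{#x, y, z#} = {#x, y', z'#}"
    if "x + y + z = x + y' + z'" "x * y + y * z + z * x = x * y' + y' * z' + z' * x" for x y z y' z' :: 'a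
  proof -
    have "y + z = y' + z'" using that(1) by algebra
    moreover then have "y * z = y' * z'" using that(2) by algebra
    ultimately show ?thesis using two by (metis)
  qed
  have "(x - x') * (x - y') * (x - z') = 0" using f[of x] by simp
  then consider "x = x'" | "x = y'" | "x = z'" by auto
  then show ?thesis
  proof cases
    case 1 then show ?thesis using three assms by metis
  next
    case 2
    have "{#x, y, z#} = {#x, z', x'#}"
      by (rule three) (use 2 assms in \<open>simp_all add: algebra_simps\<close>)
    then show ?thesis using 2 by (simp add: add_mset_commute)
  next
    case 3
    have "{#x, y, z#} = {#x, x', y'#}"
      by (rule three) (use 3 assms in \<open>simp_all add: algebra_simps\<close>)
    then show ?thesis using 3 by (simp add: add_mset_commute)
  qed
qed


text \<open>Product and sum make sense on multisets. On unit triples the second component is the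
  second elementary symmetric function, by \<open>unit_elementary\<close>.\<close>

definition invariants :: "('a \<Rightarrow> complex) \<Rightarrow> 'a multiset \<Rightarrow> complex \<times> complex" where
  "invariants \<psi> M = (prod_mset (image_mset \<psi> M), prod_mset (image_mset \<psi> M)
      * cnj (sum_mset (image_mset \<psi> M)))"

definition coords :: "('a \<Rightarrow> complex) \<Rightarrow> 'a multiset \<Rightarrow> complex \<times> real" where
  "coords \<psi> M = (fst (invariants \<psi> M), Re (snd (invariants \<psi> M)))"

text \<open>Coinciding points are allowed, which makes the set closed; it turns out to be the
  closure of the orthotripods.\<close>

definition real_triples :: "'a set \<Rightarrow> ('a \<Rightarrow> complex) \<Rightarrow> 'a multiset set" where
  "real_triples X \<psi> = {M. size M = 3 \<and> set_mset M \<subseteq> X \<and> Im (snd (invariants \<psi> M)) = 0}"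

definition roots_region :: "(complex \<times> real) set" where
  "roots_region = {p. cmod (fst p) = 1 \<and> triple_disc (fst p) (snd p) \<le> 0}"

lemma size_3_obtain:
  assumes "size M = 3"
  obtains p q s where "M = {#p, q, s#}"
proof -
  have "size M = Suc 2" using assms by simp
  from size_eq_Suc_imp_eq_union[OF this] obtain p N where N: "M = add_mset p N" by blast
  then have "size N = Suc 1" using assms by simp
  from size_eq_Suc_imp_eq_union[OF this] obtain q L where L: "N = add_mset q L" by blast
  then have "size L = 1" using assms N by simp
  then obtain s where "L = {#s#}" using size_1_singleton_mset by blast
  with N L that show thesis by blast
qed

lemma topspace_sym_cube_iff:
  "M \<in> topspace (sym_cube (top_of_set X)) \<longleftrightarrow> size M = 3 \<and> set_mset M \<subseteq> X"
proof
  assume "size M = 3 \<and> set_mset M \<subseteq> X"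
  moreover then obtain p q s where "M = {#p, q, s#}" using size_3_obtain by metis
  ultimately show "M \<in> topspace (sym_cube (top_of_set X))"
    unfolding topspace_sym_cube unordered_def by (auto intro!: image_eqI[of _ _ "(p, q, s)"])
qed (auto simp: topspace_sym_cube unordered_def)

text \<open>The symmetric cube is studied for any compact curve with a continuous bijection to the
  circle, so that the ellipse enters only through its affine chart.\<close>

locale circle_chart =
  fixes X :: "'a::topological_space set" and \<psi> :: "'a \<Rightarrow> complex"
  assumes compact: "compact X" and cont: "continuous_on X \<psi>"
    and bij: "bij_betw \<psi> X (sphere 0 1)"
begin

lemma unit: "p \<in> X \<Longrightarrow> cmod (\<psi> p) = 1"
  using bij_betwE[OF bij] by auto

lemma nonzero: "p \<in> X \<Longrightarrow> \<psi> p \<noteq> 0"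
  using unit by fastforce

lemma inj: "p \<in> X \<Longrightarrow> q \<in> X \<Longrightarrow> \<psi> p = \<psi> q \<longleftrightarrow> p = q"
  using bij_betw_imp_inj_on[OF bij] by (auto dest: inj_onD)

lemma invariants_triple:
  assumes "p \<in> X" "q \<in> X" "s \<in> X"
  shows "invariants \<psi> {#p, q, s#} = (\<psi> p * \<psi> q * \<psi> s, \<psi> p * \<psi> q + \<psi> q * \<psi> s + \<psi> s * \<psi> p)"
  unfolding unit_elementary[OF unit[OF assms(1)] unit[OF assms(2)] unit[OF assms(3)]] invariants_def
  by (simp add: mult_ac add_ac)

lemma continuous_invariants:
  "continuous_map (sym_cube (top_of_set X)) euclidean (invariants \<psi>)"
  unfolding continuous_map_sym_cube cube_topology_top_of_set continuous_map_iff_continuous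
    comp_def unordered_def invariants_def case_prod_beta
  by (auto intro!: continuous_intros continuous_on_compose2[OF cont])

text \<open>As the product is nonzero, the second invariant determines the sum. All elementary
  symmetric functions then agree, so the images under \<psi> do, and \<psi> is injective.\<close>

lemma inj_invariants: "inj_on (invariants \<psi>) (topspace (sym_cube (top_of_set X)))"
proof (rule inj_onI)
  fix M N assume "M \<in> topspace (sym_cube (top_of_set X))" "N \<in> topspace (sym_cube (top_of_set X))"
    and eq: "invariants \<psi> M = invariants \<psi> N"
  then have M: "size M = 3" "set_mset M \<subseteq> X" and N: "size N = 3" "set_mset N \<subseteq> X"
    unfolding topspace_sym_cube_iff by auto
  obtain p q s where pqs: "M = {#p, q, s#}" using M(1) by (rule size_3_obtain)
  obtain p' q' s' where pqs': "N = {#p', q', s'#}" using N(1) by (rule size_3_obtain)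
  have X: "p \<in> X" "q \<in> X" "s \<in> X" "p' \<in> X" "q' \<in> X" "s' \<in> X"
    using M N pqs pqs' by auto
  have e: "\<psi> p * \<psi> q * \<psi> s = \<psi> p' * \<psi> q' * \<psi> s'"
    "\<psi> p * \<psi> q + \<psi> q * \<psi> s + \<psi> s * \<psi> p = \<psi> p' * \<psi> q' + \<psi> q' * \<psi> s' + \<psi> s' * \<psi> p'"
    using eq unfolding pqs pqs' invariants_triple[OF X(1,2,3)] invariants_triple[OF X(4,5,6)] by auto
  have "\<psi> p * \<psi> q * \<psi> s \<noteq> 0" using X by (simp add: nonzero)
  then have "cnj (\<psi> p + \<psi> q + \<psi> s) = cnj (\<psi> p' + \<psi> q' + \<psi> s')"
    using e X unit by (simp only: unit_elementary mult_cancel_left) simp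
  then have "\<psi> p + \<psi> q + \<psi> s = \<psi> p' + \<psi> q' + \<psi> s'" by (simp only: complex_cnj_cancel_iff)
  then have "image_mset \<psi> M = image_mset \<psi> N"
    unfolding pqs pqs' using triple_eq_if_elementary_eq e by simp
  moreover have "image_mset (inv_into X \<psi>) (image_mset \<psi> L) = L" if "set_mset L \<subseteq> X" for L
    using that bij_betw_imp_inj_on[OF bij]
    by (auto simp: multiset.map_comp intro!: multiset.map_ident_strong inv_into_f_f)
  ultimately show "M = N" using M(2) N(2) by metis
qed

lemma triple_in_real_triples:
  assumes "p \<in> X" "q \<in> X" "s \<in> X"
  shows "{#p, q, s#} \<in> real_triples X \<psi> \<longleftrightarrow> Im (\<psi> p * \<psi> q + \<psi> q * \<psi> s + \<psi> s * \<psi> p) = 0"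
  unfolding real_triples_def using assms invariants_triple[OF assms] by simp

lemma real_triple_obtain:
  assumes "M \<in> real_triples X \<psi>"
  obtains p q s where "M = {#p, q, s#}" "p \<in> X" "q \<in> X" "s \<in> X"
    "\<psi> p + \<psi> q + \<psi> s = snd (coords \<psi> M) * fst (coords \<psi> M)"
    "\<psi> p * \<psi> q + \<psi> q * \<psi> s + \<psi> s * \<psi> p = snd (coords \<psi> M)"
    "\<psi> p * \<psi> q * \<psi> s = fst (coords \<psi> M)"
proof -
  obtain p q s where pqs: "M = {#p, q, s#}"
    using assms unfolding real_triples_def by (auto elim: size_3_obtain)
  have X: "p \<in> X" "q \<in> X" "s \<in> X" using assms unfolding pqs real_triples_def by auto
  have "Im (\<psi> p * \<psi> q + \<psi> q * \<psi> s + \<psi> s * \<psi> p) = 0"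
    using assms triple_in_real_triples[OF X] unfolding pqs by blast
  then show thesis
    using unit_elementary_real[OF unit[OF X(1)] unit[OF X(2)] unit[OF X(3)]]
    by (intro that[OF pqs X]) (auto simp: coords_def pqs invariants_triple[OF X])
qed

lemma triple_disc_coords:
  assumes M: "M \<in> real_triples X \<psi>"
  shows "coords \<psi> M \<in> roots_region"
    and "triple_disc (fst (coords \<psi> M)) (snd (coords \<psi> M)) < 0 \<longleftrightarrow> card (set_mset M) = 3"
proof -
  obtain p q s where M: "M = {#p, q, s#}" and X: "p \<in> X" "q \<in> X" "s \<in> X"
    and e: "\<psi> p + \<psi> q + \<psi> s = snd (coords \<psi> M) * fst (coords \<psi> M)"
    "\<psi> p * \<psi> q + \<psi> q * \<psi> s + \<psi> s * \<psi> p = snd (coords \<psi> M)"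
    "\<psi> p * \<psi> q * \<psi> s = fst (coords \<psi> M)"
    using assms by (rule real_triple_obtain)
  note u = unit[OF X(1)] unit[OF X(2)] unit[OF X(3)]
  have "cmod (fst (coords \<psi> M)) = 1" using u by (simp add: e(3)[symmetric] norm_mult)
  then show "coords \<psi> M \<in> roots_region"
    unfolding roots_region_def using triple_disc_eq_dist[OF u e] by simp
  have "triple_disc (fst (coords \<psi> M)) (snd (coords \<psi> M)) < 0 \<longleftrightarrow> p \<noteq> q \<and> q \<noteq> s \<and> s \<noteq> p"
    unfolding triple_disc_eq_dist[OF u e] using inj X by auto
  also have "\<dots> \<longleftrightarrow> card (set_mset M) = 3" unfolding M by (auto simp: card_insert_if)
  finally show "triple_disc (fst (coords \<psi> M)) (snd (coords \<psi> M)) < 0 \<longleftrightarrow> card (set_mset M) = 3" .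
qed

lemma coords_image: "coords \<psi> ` real_triples X \<psi> = roots_region"
proof
  show "coords \<psi> ` real_triples X \<psi> \<subseteq> roots_region" using triple_disc_coords(1) by blast
  show "roots_region \<subseteq> coords \<psi> ` real_triples X \<psi>"
  proof
    fix a assume "a \<in> roots_region"
    then have "cmod (fst a) = 1" "triple_disc (fst a) (snd a) \<le> 0" unfolding roots_region_def by auto
    then obtain x y z :: complex where u: "cmod x = 1" "cmod y = 1" "cmod z = 1"
      and e: "x * y + y * z + z * x = snd a" "x * y * z = fst a"
      by (rule unit_roots_if_triple_disc_nonpos)
    then have "x \<in> \<psi> ` X" "y \<in> \<psi> ` X" "z \<in> \<psi> ` X"
      using bij_betw_imp_surj_on[OF bij] by auto
    then obtain p q s where X: "p \<in> X" "q \<in> X" "s \<in> X" and xyz: "x = \<psi> p" "y = \<psi> q" "z = \<psi> s"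
      by blast
    have "{#p, q, s#} \<in> real_triples X \<psi>"
      unfolding triple_in_real_triples[OF X] using e(1) xyz by simp
    moreover have "coords \<psi> {#p, q, s#} = a"
      unfolding coords_def invariants_triple[OF X] using e xyz by (simp add: prod_eq_iff)
    ultimately show "a \<in> coords \<psi> ` real_triples X \<psi>" by (metis imageI)
  qed
qed

lemma closedin_real_triples: "closedin (sym_cube (top_of_set X)) (real_triples X \<psi>)"
proof -
  have "closed {a :: complex \<times> complex. Im (snd a) = 0}"
    by (intro closed_Collect_eq continuous_intros)
  then have "closedin (sym_cube (top_of_set X))
     {M \<in> topspace (sym_cube (top_of_set X)). invariants \<psi> M \<in> {a. Im (snd a) = 0}}"
    by (intro closedin_continuous_map_preimage[OF continuous_invariants]) simp
  moreover have "{M \<in> topspace (sym_cube (top_of_set X)). invariants \<psi> M \<in> {a. Im (snd a) = 0}}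
      = real_triples X \<psi>"
    unfolding real_triples_def topspace_sym_cube_iff by auto
  ultimately show ?thesis by metis
qed

text \<open>A continuous bijection from a compact space to a Hausdorff space; the domain is compact
  as a closed subset of the symmetric cube.\<close>

lemma homeomorphic_map_coords:
  "homeomorphic_map (subtopology (sym_cube (top_of_set X)) (real_triples X \<psi>))
     (top_of_set roots_region) (coords \<psi>)"
proof (rule continuous_imp_homeomorphic_map)
  have ts: "real_triples X \<psi> \<subseteq> topspace (sym_cube (top_of_set X))"
    using closedin_real_triples by (rule closedin_subset)
  then have top: "topspace (subtopology (sym_cube (top_of_set X)) (real_triples X \<psi>)) = real_triples X \<psi>"
    by auto
  have "continuous_map euclidean euclidean (\<lambda>a :: complex \<times> complex. (fst a, Re (snd a)))"
    by (auto intro!: continuous_intros)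
  from continuous_map_compose[OF continuous_invariants this]
  have "continuous_map (sym_cube (top_of_set X)) euclidean (coords \<psi>)"
    by (simp add: comp_def coords_def[abs_def])
  then show "continuous_map (subtopology (sym_cube (top_of_set X)) (real_triples X \<psi>))
     (top_of_set roots_region) (coords \<psi>)"
    unfolding continuous_map_in_subtopology top
    using coords_image by (auto intro: continuous_map_from_subtopology)
  have "compact_space (sym_cube (top_of_set X))"
    by (rule compact_space_sym_cube) (simp add: compact compact_space_subtopology)
  then show "compact_space (subtopology (sym_cube (top_of_set X)) (real_triples X \<psi>))"
    using closedin_real_triples closedin_compact_space compact_space_subtopology by blast
  show "Hausdorff_space (top_of_set roots_region)"
    by (simp add: Hausdorff_space_subtopology)
  show "coords \<psi> ` topspace (subtopology (sym_cube (top_of_set X)) (real_triples X \<psi>)) =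
    topspace (top_of_set roots_region)"
    unfolding top coords_image by simp
  show "inj_on (coords \<psi>) (topspace (subtopology (sym_cube (top_of_set X)) (real_triples X \<psi>)))"
    unfolding top
  proof (rule inj_onI)
    fix M N assume M: "M \<in> real_triples X \<psi>" and N: "N \<in> real_triples X \<psi>" and "coords \<psi> M = coords \<psi> N"
    then have "invariants \<psi> M = invariants \<psi> N"
      unfolding coords_def real_triples_def by (auto simp: prod_eq_iff complex_eq_iff)
    then show "M = N" using inj_invariants M N ts by (auto dest: inj_onD)
  qed
qed

end

section \<open>The two regions are cylinders\<close>

definition quart :: "real \<Rightarrow> real \<Rightarrow> real" where
  "quart k r = r^2 * (r^2 - 8 * k * r + 18)"

lemma triple_disc_quart: "triple_disc w r = quart (Re (w^2)) r - 27"
  unfolding triple_disc_def quart_def by algebra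

lemma quart_minus: "quart (- k) (- r) = quart k r"
  unfolding quart_def by simp

text \<open>The difference divided by \<open>s - r\<close> is a polynomial in
  \<open>p = s + r\<close> and \<open>m = s * r\<close>. It is smallest at \<open>k = 1\<close>, so
  positivity is only needed there.\<close>

lemma quart_strict_mono:
  assumes k: "\<bar>k\<bar> \<le> 1" and r: "0 \<le> r" "r < s"
  shows "quart k r < quart k s"
proof -
  define p m where "p = s + r" and "m = s * r"
  have p: "0 < p" and m: "0 \<le> m" unfolding p_def m_def using r by auto
  have "p^2 - 4 * m = (s - r)^2" unfolding p_def m_def by algebra
  then have pm: "0 < p^2 - 4 * m" using r by simp
  \<comment> \<open>For \<open>k = 1\<close> the quotient is linear in \<open>m\<close>. The
    identity interpolates between its values \<open>p * ((p - 4)^2 + 2)\<close> at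
    \<open>m = 0\<close> and \<open>p * (p - 6)^2 / 2\<close> at \<open>m = p^2 / 4\<close>.\<close>
  have id: "p^2 * (p^3 - 8 * p^2 + 18 * p - 2 * p * m + 8 * m)
     = (p^2 - 4 * m) * (p * ((p - 4)^2 + 2)) + 2 * m * (p * (p - 6)^2)"
    by algebra
  have "0 < (p^2 - 4 * m) * (p * ((p - 4)^2 + 2))"
    using p pm by (intro mult_pos_pos add_nonneg_pos) auto
  moreover have "0 \<le> 2 * m * (p * (p - 6)^2)" using p m by simp
  ultimately have "0 < p^2 * (p^3 - 8 * p^2 + 18 * p - 2 * p * m + 8 * m)"
    unfolding id by linarith
  then have "0 < p^3 - 8 * p^2 + 18 * p - 2 * p * m + 8 * m"
    using p by (simp add: zero_less_mult_iff)
  also have "\<dots> \<le> p^3 - 8 * k * (p^2 - m) + 18 * p - 2 * p * m"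
  proof -
    have "k * (p^2 - m) \<le> 1 * (p^2 - m)" using k m pm by (intro mult_right_mono) auto
    then show ?thesis by (simp add: algebra_simps)
  qed
  finally have "0 < (s - r) * (p^3 - 8 * k * (p^2 - m) + 18 * p - 2 * p * m)"
    using r by simp
  also have "\<dots> = quart k s - quart k r" unfolding p_def m_def quart_def by algebra
  finally show ?thesis by simp
qed

lemma abs_Re_power2_le: "cmod w = 1 \<Longrightarrow> \<bar>Re (w^2)\<bar> \<le> 1"
  by (metis abs_Re_le_cmod norm_power power_one)

text \<open>By monotonicity each fibre of \<open>roots_region\<close> is star-shaped about 0, and
  shrinking makes the inequality strict. Negative \<open>r\<close> are reflected by
  \<open>quart_minus\<close>.\<close>

lemma triple_disc_shrink:
  assumes w: "cmod w = 1" and d: "triple_disc w r \<le> 0" and t: "0 \<le> t" "t < 1"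
  shows "triple_disc w (t * r) < 0"
proof -
  have k: "\<bar>k\<bar> \<le> 1 \<Longrightarrow> 0 < r \<Longrightarrow> quart k r \<le> 27 \<Longrightarrow> quart k (t * r) < 27" for k r
    using quart_strict_mono[of k "t * r" r] t by simp
  note kw = abs_Re_power2_le[OF w]
  consider "r = 0" | "0 < r" | "r < 0" by linarith
  then show ?thesis
  proof cases
    case 1 then show ?thesis unfolding triple_disc_quart quart_def by simp
  next
    case 2 then show ?thesis using k[OF kw 2] d unfolding triple_disc_quart by simp
  next
    case 3
    then show ?thesis
      using k[of "- Re (w^2)" "- r"] kw d quart_minus[of "Re (w^2)"] unfolding triple_disc_quart by simp
  qed
qed

text \<open>Since \<open>triple_disc w r = quart (Re (w\<^sup>2)) r - 27\<close>, this is an increasing coordinate on each fibre of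
  \<open>roots_region\<close> that takes the values \<open>0\<close> and \<open>1\<close> at the ends.\<close>

definition height :: "real \<Rightarrow> real \<Rightarrow> real" where
  "height k r = (1 + r * \<bar>r\<bar> * (r^2 - 8 * k * r + 18) / 27) / 2"

lemma height_nonneg: "0 \<le> r \<Longrightarrow> height k r = (1 + quart k r / 27) / 2"
  unfolding height_def quart_def by (simp add: power2_eq_square)

lemma height_neg: "r \<le> 0 \<Longrightarrow> height k r = (1 - quart (- k) (- r) / 27) / 2"
  unfolding height_def quart_def by (simp add: power2_eq_square)

lemma quart_nonneg: "\<bar>k\<bar> \<le> 1 \<Longrightarrow> 0 \<le> r \<Longrightarrow> 0 \<le> quart k r"
  using quart_strict_mono[of k 0 r] by (cases "r = 0") (auto simp: quart_def)

lemma height_strict_mono: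
  assumes k: "\<bar>k\<bar> \<le> 1" and "r < s"
  shows "height k r < height k s"
proof -
  have k': "\<bar>- k\<bar> \<le> 1" using k by simp
  consider "0 \<le> r" | "s \<le> 0" | "r < 0" "0 < s" by linarith
  then show ?thesis
  proof cases
    case 1 then show ?thesis using assms quart_strict_mono[OF k, of r s] by (simp add: height_nonneg)
  next
    case 2 then show ?thesis using assms quart_strict_mono[OF k', of "- s" "- r"] by (simp add: height_neg)
  next
    case 3
    then have "height k r = (1 - quart (- k) (- r) / 27) / 2" "height k s = (1 + quart k s / 27) / 2"
      by (simp_all only: height_neg height_nonneg less_imp_le)
    moreover have "0 \<le> quart k s" using 3 by (intro quart_nonneg[OF k]) simp
    moreover have "quart (- k) 0 < quart (- k) (- r)" using 3 by (intro quart_strict_mono[OF k']) auto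
    ultimately show ?thesis by (simp add: quart_def[of "- k" 0])
  qed
qed

lemma quart_surj:
  assumes k: "\<bar>k\<bar> \<le> 1" and t: "0 \<le> t" "t \<le> 27"
  obtains r where "0 \<le> r" "quart k r = t"
proof -
  \<comment> \<open>The value at 3 decreases in \<open>k\<close> and equals 27 at
    \<open>k = 1\<close>, so 3 bounds the fibres uniformly.\<close>
  have "27 \<le> quart k 3" unfolding quart_def using k by simp
  moreover have "continuous_on {0..3} (quart k)"
    unfolding quart_def[abs_def] by (intro continuous_intros)
  ultimately have "\<exists>r\<ge>0. r \<le> 3 \<and> quart k r = t"
    using t by (intro IVT') (auto simp: quart_def)
  then show thesis using that by blast
qed

lemma height_surj:
  assumes k: "\<bar>k\<bar> \<le> 1" and t: "0 \<le> t" "t \<le> 1"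
  obtains r where "height k r = t" "quart k r \<le> 27"
proof (cases "1 / 2 \<le> t")
  case True
  then obtain r where "0 \<le> r" "quart k r = 27 * (2 * t - 1)"
    using quart_surj[OF k, of "27 * (2 * t - 1)"] t by auto
  then show thesis using t by (intro that[of r]) (auto simp: height_nonneg field_simps)
next
  case False
  then obtain r where "0 \<le> r" "quart (- k) r = 27 * (1 - 2 * t)"
    using quart_surj[of "- k" "27 * (1 - 2 * t)"] t k by auto
  then show thesis
    using t quart_minus[of "- k" r] by (intro that[of "- r"]) (auto simp: height_neg field_simps)
qed

lemma height_range:
  assumes k: "\<bar>k\<bar> \<le> 1" and "quart k r \<le> 27"
  shows "0 \<le> height k r \<and> height k r \<le> 1"
proof (cases "0 \<le> r")
  case True
  then show ?thesis using assms quart_nonneg[OF k True] by (simp add: height_nonneg)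
next
  case False
  then show ?thesis using assms quart_nonneg[of "- k" "- r"] quart_minus[of k r]
    by (simp add: height_neg)
qed

lemma compact_roots_region: "compact roots_region"
proof -
  have b: "\<bar>r\<bar> \<le> 3" if "cmod w = 1" "triple_disc w r \<le> 0" for w r
  proof (rule ccontr)
    have *: False if "\<bar>k\<bar> \<le> 1" "quart k s \<le> 27" "3 < s" for k s
    proof -
      have "27 \<le> quart k 3" unfolding quart_def using that(1) by simp
      then show False using quart_strict_mono[OF that(1), of 3 s] that by simp
    qed
    assume "\<not> \<bar>r\<bar> \<le> 3"
    then consider "3 < r" | "3 < - r" by linarith
    then show False
      using *[of "Re (w^2)" r] *[of "- Re (w^2)" "- r"] quart_minus[of "Re (w^2)" r]
        that abs_Re_power2_le[OF that(1)] unfolding triple_disc_quart by cases auto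
  qed
  have "roots_region = (sphere 0 1 \<times> {-3..3}) \<inter> {p. triple_disc (fst p) (snd p) \<le> 0}"
    unfolding roots_region_def using b by (auto simp: abs_le_iff) (smt (verit) b)+
  moreover have "closed {p. triple_disc (fst p) (snd p) \<le> 0}"
    unfolding triple_disc_def by (intro closed_Collect_le continuous_intros)
  ultimately show ?thesis
    using compact_Int_closed[OF compact_Times[OF compact_sphere compact_Icc]] by metis
qed

lemma cylinder_eq: "cylinder I = top_of_set (sphere 0 1 \<times> I)"
  by (simp add: subtopology_Times[symmetric])

text \<open>Each fibre is straightened by \<open>height\<close>; compactness of
  \<open>roots_region\<close> supplies continuity of the inverse.\<close>

lemma roots_region_homeomorphic_cylinder: "top_of_set roots_region homeomorphic_space cylinder {0..1}"
proof -
  define f where "f = (\<lambda>p. (fst p, height (Re (fst p^2)) (snd p)))"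
  have unit: "\<bar>Re (fst p^2)\<bar> \<le> 1" if "p \<in> roots_region" for p
    using that abs_Re_power2_le unfolding roots_region_def by blast
  have q: "quart (Re (fst p^2)) (snd p) \<le> 27" if "p \<in> roots_region" for p
    using that unfolding roots_region_def triple_disc_quart by simp
  have img: "f ` roots_region = sphere 0 1 \<times> {0..1}"
  proof
    show "f ` roots_region \<subseteq> sphere 0 1 \<times> {0..1}"
      using height_range unit q unfolding f_def roots_region_def by auto
    show "sphere 0 1 \<times> {0..1} \<subseteq> f ` roots_region"
    proof
      fix a :: "complex \<times> real" assume a: "a \<in> sphere 0 1 \<times> {0..1}"
      then have w: "cmod (fst a) = 1" by auto
      have "0 \<le> snd a" "snd a \<le> 1" using a by auto
      then obtain r where r: "height (Re (fst a^2)) r = snd a" "quart (Re (fst a^2)) r \<le> 27"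
        by (rule height_surj[OF abs_Re_power2_le[OF w]])
      then have "(fst a, r) \<in> roots_region" "a = f (fst a, r)"
        unfolding roots_region_def triple_disc_quart f_def using w by (auto simp: prod_eq_iff)
      then show "a \<in> f ` roots_region" by blast
    qed
  qed
  have "homeomorphic_map (top_of_set roots_region) (top_of_set (sphere 0 1 \<times> {0..1})) f"
  proof (rule continuous_imp_homeomorphic_map)
    have "continuous_on roots_region f"
      unfolding f_def height_def by (intro continuous_intros) auto
    then show "continuous_map (top_of_set roots_region) (top_of_set (sphere 0 1 \<times> {0..1})) f"
      using img by (simp add: continuous_map_in_subtopology) blast
    show "compact_space (top_of_set roots_region)"
      using compact_roots_region by (simp add: compact_space_subtopology)
    show "Hausdorff_space (top_of_set (sphere 0 1 \<times> {0..1}) :: (complex \<times> real) topology)"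
      by (simp add: Hausdorff_space_subtopology)
    show "f ` topspace (top_of_set roots_region) = topspace (top_of_set (sphere 0 1 \<times> {0..1}))"
      using img by simp
    have "inj_on f roots_region"
    proof (rule inj_onI)
      fix p p' assume p: "p \<in> roots_region" "p' \<in> roots_region" and eq: "f p = f p'"
      then have "fst p = fst p'" "height (Re (fst p^2)) (snd p) = height (Re (fst p^2)) (snd p')"
        unfolding f_def by auto
      then show "p = p'"
        using height_strict_mono[OF unit[OF p(1)]] by (metis less_irrefl linorder_neqE prod_eqI)
    qed
    then show "inj_on f (topspace (top_of_set roots_region))" by simp
  qed
  then show ?thesis
    unfolding cylinder_eq by (rule homeomorphic_map_imp_homeomorphic_space)
qed

section \<open>The region of balanced triples\<close>

definition balance_region :: "real \<Rightarrow> real \<Rightarrow> (complex \<times> real) set" where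
  "balance_region A B = {p. cmod (fst p) = 1 \<and> -1 < snd p \<and> snd p < 1
      \<and> 0 < balance_form A B (fst p) (snd p)}"

text \<open>The form is \<open>P w - Q w * r\<close> with \<open>Q w\<close> positive, so the fibre
  over \<open>w\<close> is the interval from -1 to \<open>R w\<close>, nonempty because
  \<open>P w + Q w\<close> is positive. An affine map rescales it to the unit interval; without
  compactness the inverse \<open>g\<close> is given explicitly.\<close>

lemma balance_region_homeomorphic_cylinder:
  assumes B: "0 < B" and A: "B < A"
  shows "top_of_set (balance_region A B) homeomorphic_space cylinder {0<..<1}"
proof -
  define P where "P w = B^2 * (Re w)^2 * (3 * A - B) + A^2 * (Im w)^2 * (3 * B - A)" for w
  define Q where "Q w = (A - B) * (B^2 * (Re w)^2 + A^2 * (Im w)^2)" for w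
  define R where "R w = min 1 (P w / Q w)" for w
  have balance_form: "balance_form A B w r = P w - Q w * r" for w r
    unfolding balance_form_def P_def Q_def by algebra
  have Q: "0 < Q w" if "cmod w = 1" for w
  proof -
    have "Re w \<noteq> 0 \<or> Im w \<noteq> 0" using that by (auto simp: cmod_def)
    then show ?thesis unfolding Q_def using A B
      by (intro mult_pos_pos) (auto simp: add_pos_nonneg add_nonneg_pos)
  qed
  have R: "-1 < R w" if "cmod w = 1" for w
  proof -
    have "P w + Q w = 2 * B^2 * (Re w)^2 * (2 * A - B) + 2 * A^2 * (Im w)^2 * B"
      unfolding P_def Q_def by algebra
    moreover have "0 < \<dots>"
    proof -
      have "Re w \<noteq> 0 \<or> Im w \<noteq> 0" using that by (auto simp: cmod_def)
      then show ?thesis using A B by (auto simp: add_pos_nonneg add_nonneg_pos)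
    qed
    ultimately have "- Q w < P w" by linarith
    then show ?thesis unfolding R_def using Q[OF that] by (simp add: pos_less_divide_eq)
  qed
  have mem: "(w, r) \<in> balance_region A B \<longleftrightarrow> cmod w = 1 \<and> -1 < r \<and> r < R w" for w r
    unfolding balance_region_def balance_form R_def using Q[of w]
        by (auto simp: pos_less_divide_eq mult.commute)
  have contR: "continuous_on S (\<lambda>p. R (fst p))" if "S \<subseteq> sphere 0 1 \<times> UNIV" for S :: "(complex \<times> real) set"
  proof -
    have "Q (fst p) \<noteq> 0" if "p \<in> S" for p
      using Q[of "fst p"] that \<open>S \<subseteq> _\<close> by force
    moreover have "continuous_on S (\<lambda>p. P (fst p))" "continuous_on S (\<lambda>p. Q (fst p))"
      unfolding P_def Q_def by (intro continuous_intros)+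
    ultimately show ?thesis unfolding R_def by (intro continuous_on_min continuous_on_const
        continuous_on_divide) auto
  qed
  define f where "f p = (fst p, (snd p + 1) / (R (fst p) + 1))" for p
  define g where "g p = (fst p, snd p * (R (fst p) + 1) - 1)" for p
  have nz: "R (fst p) + 1 \<noteq> 0" if "p \<in> balance_region A B" for p
    using that R[of "fst p"] unfolding balance_region_def by auto
  have "homeomorphic_maps (top_of_set (balance_region A B)) (top_of_set (sphere 0 1 \<times> {0<..<1})) f g"
    unfolding homeomorphic_maps_def continuous_map_in_subtopology
  proof (intro conjI ballI)
    have "continuous_on (balance_region A B) f"
      unfolding f_def using nz by (intro continuous_intros contR) (auto simp: balance_region_def)
    then show "continuous_map (top_of_set (balance_region A B)) euclidean f" by simp
    have "continuous_on (sphere 0 1 \<times> {0<..<1}) g"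
      unfolding g_def by (intro continuous_intros contR) auto
    then show "continuous_map (top_of_set (sphere 0 1 \<times> {0<..<1})) euclidean g" by simp
    show "f \<in> topspace (top_of_set (balance_region A B)) \<rightarrow> sphere 0 1 \<times> {0<..<1}"
      using R by (fastforce simp: f_def mem)
    show "g \<in> topspace (top_of_set (sphere 0 1 \<times> {0<..<1})) \<rightarrow> balance_region A B"
    proof -
      have "t * (R w + 1) < 1 * (R w + 1)" if "cmod w = 1" "t < 1" for w t
        using R[OF that(1)] that(2) by (intro mult_strict_right_mono) auto
      then show ?thesis using R by (fastforce simp: g_def mem)
    qed
    fix p assume "p \<in> topspace (top_of_set (balance_region A B))"
    then show "g (f p) = p" using nz[of p] by (simp add: f_def g_def)
  next
    fix p :: "complex \<times> real" assume "p \<in> topspace (top_of_set (sphere 0 1 \<times> {0<..<1}))"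
    then show "f (g p) = p" using R[of "fst p"] by (auto simp: f_def g_def)
  qed
  then show ?thesis unfolding cylinder_eq homeomorphic_space_def by blast
qed

text \<open>At \<open>r = 1\<close> and \<open>r = -1\<close> the discriminant is
  \<open>- 8 - 8 * Re (w^2)\<close> or \<open>- 8 + 8 * Re (w^2)\<close>, up to order; neither is
  positive, and the rest is shrinking.\<close>

lemma triple_disc_neg_if_abs_less_1:
  assumes w: "cmod w = 1" and r: "\<bar>r\<bar> < 1"
  shows "triple_disc w r < 0"
proof -
  have k: "\<bar>Re (w^2)\<bar> \<le> 1" by (rule abs_Re_power2_le[OF w])
  have "triple_disc w 1 \<le> 0" "triple_disc w (-1) \<le> 0" unfolding triple_disc_def using k by auto
  note this[THEN triple_disc_shrink[OF w _ abs_ge_zero r]]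
  then show ?thesis by (cases "0 \<le> r") simp_all
qed

lemma roots_region_subset_closure:
  "roots_region \<subseteq> closure {p \<in> roots_region. triple_disc (fst p) (snd p) < 0}"
proof
  fix p assume p: "p \<in> roots_region"
  define f where "f n = (fst p, (1 - inverse (real (Suc n))) * snd p)" for n
  have "f n \<in> {p \<in> roots_region. triple_disc (fst p) (snd p) < 0}" for n
  proof -
    have "0 \<le> 1 - inverse (real (Suc n))" "1 - inverse (real (Suc n)) < 1"
      by (simp_all add: field_simps)
    then have "triple_disc (fst p) ((1 - inverse (real (Suc n))) * snd p) < 0"
      using p unfolding roots_region_def by (intro triple_disc_shrink) auto
    then show ?thesis using p unfolding f_def roots_region_def by auto
  qed
  moreover have "f \<longlonglongrightarrow> (fst p, (1 - 0) * snd p)"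
    unfolding f_def by (intro tendsto_intros LIMSEQ_inverse_real_of_nat)
  ultimately show "p \<in> closure {p \<in> roots_region. triple_disc (fst p) (snd p) < 0}"
    unfolding closure_sequential by auto
qed

lemma balance_region_subset: "balance_region A B \<subseteq> roots_region"
proof
  fix p assume "p \<in> balance_region A B"
  then have "cmod (fst p) = 1" "\<bar>snd p\<bar> < 1" unfolding balance_region_def by auto
  then show "p \<in> roots_region"
    unfolding roots_region_def using triple_disc_neg_if_abs_less_1 less_imp_le by blast
qed

section \<open>Geometry of the ellipse\<close>

text \<open>The matrix with columns \<open>u\<close> and \<open>v\<close> is orthogonal, hence its
  rows are orthonormal too.\<close>

lemma orthonormal_expand_real2:
  fixes u v p :: "real^2"
  assumes "norm u = 1" "norm v = 1" "orthogonal u v"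
  shows "p = (p \<bullet> u) *\<^sub>R u + (p \<bullet> v) *\<^sub>R v"
proof -
  have h: "(u$1)^2 + (u$2)^2 = 1" "(v$1)^2 + (v$2)^2 = 1" "u$1 * v$1 + u$2 * v$2 = 0"
    using assms unfolding norm_eq_1 orthogonal_def inner_vec_def sum_2
    by (simp_all add: power2_eq_square)
  have a: "(u$1)^2 + (v$1)^2 = 1" "(u$2)^2 + (v$2)^2 = 1" "u$1 * u$2 + v$1 * v$2 = 0"
    using h by algebra+
  have "p$1 = (p$1 * u$1 + p$2 * u$2) * u$1 + (p$1 * v$1 + p$2 * v$2) * v$1"
    "p$2 = (p$1 * u$1 + p$2 * u$2) * u$2 + (p$1 * v$1 + p$2 * v$2) * v$2"
    using a by algebra+
  then show ?thesis
    by (simp add: vec_eq_iff forall_2 inner_vec_def sum_2)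
qed

lemma coulomb_force_triple:
  assumes "p \<noteq> q" "q \<noteq> s" "s \<noteq> p"
  shows "coulomb_force k {p, q, s} p =
    (k p * k q / dist p q ^ 3) *\<^sub>R (p - q) + (k p * k s / dist p s ^ 3) *\<^sub>R (p - s)"
proof -
  have "{p, q, s} - {p} = {q, s}" using assms by auto
  then show ?thesis unfolding coulomb_force_def using assms by simp
qed

text \<open>The circle is excluded by unequal semi-axes; their order is a matter of naming, settled
  in \<open>ellipse_obtain\<close>.\<close>

locale ellipse =
  fixes c u v :: "real^2" and a b :: real
  assumes norm_u: "norm u = 1" and norm_v: "norm v = 1" and uv: "orthogonal u v"
    and b_pos: "0 < b" and b_less_a: "b < a"
begin

definition X :: "(real^2) set" where
  "X = {p. (((p - c) \<bullet> u) / a)\<^sup>2 + (((p - c) \<bullet> v) / b)\<^sup>2 = 1}"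

definition chart :: "real^2 \<Rightarrow> complex" where
  "chart p = Complex (((p - c) \<bullet> u) / a) (((p - c) \<bullet> v) / b)"

definition point :: "complex \<Rightarrow> real^2" where
  "point z = c + (a * Re z) *\<^sub>R u + (b * Im z) *\<^sub>R v"

definition tangent :: "complex \<Rightarrow> real^2" where
  "tangent z = (- (a * Im z)) *\<^sub>R u + (b * Re z) *\<^sub>R v"

abbreviation nf :: "complex \<Rightarrow> complex \<Rightarrow> real" where
  "nf \<equiv> normal_form (a^2) (b^2)"

lemma a_pos: "0 < a" using b_pos b_less_a by simp

lemma inner_simps:
  "u \<bullet> u = 1" "v \<bullet> v = 1" "u \<bullet> v = 0" "v \<bullet> u = 0"
  using norm_u norm_v uv by (simp_all add: norm_eq_1 orthogonal_def inner_commute)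

lemma point_chart: "point (chart p) = p"
  using a_pos b_pos
  unfolding point_def chart_def by (simp add: add.assoc flip: orthonormal_expand_real2[OF norm_u norm_v uv])

lemma chart_point: "chart (point z) = z"
  unfolding point_def chart_def using a_pos b_pos
  by (simp add: complex_eq_iff inner_add_left inner_simps)

lemma X_iff: "p \<in> X \<longleftrightarrow> cmod (chart p) = 1"
  unfolding X_def chart_def by (simp add: cmod_def)

lemma point_in_X: "point z \<in> X \<longleftrightarrow> cmod z = 1"
  by (simp add: X_iff chart_point)

lemma point_eq_iff: "point z = point z' \<longleftrightarrow> z = z'"
  by (metis chart_point)

lemma continuous_point: "continuous_on S point"
  unfolding point_def by (intro continuous_intros)

sublocale circle_chart X chart
proof
  have X: "X = point ` sphere 0 1"
    using X_iff point_chart by (auto simp: chart_point intro: rev_image_eqI)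
  show "compact X" unfolding X by (intro compact_continuous_image continuous_point) simp
  show "continuous_on X chart"
    unfolding chart_def complex_eq by (intro continuous_intros) (use a_pos b_pos in auto)
  show "bij_betw chart X (sphere 0 1)"
    by (rule bij_betwI[where g = point]) (auto simp: X_iff chart_point point_chart)
qed

text \<open>Differentiating the equation of the ellipse along a curve confines the velocity to a
  line. Conversely, rotating \<open>z\<close> with angular speed \<open>t\<close> realises every
  multiple of \<open>tangent z\<close>.\<close>

lemma tangent_vector_point:
  assumes z: "cmod z = 1"
  shows "tangent_vector X (point z) y \<longleftrightarrow> (\<exists>t. y = t *\<^sub>R tangent z)"
proof
  assume "tangent_vector X (point z) y"
  then obtain \<gamma> where g: "range \<gamma> \<subseteq> X" "\<gamma> 0 = point z" "(\<gamma> has_vector_derivative y) (at (0::real))"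
    unfolding tangent_vector_def by blast
  have d: "((\<lambda>s. (\<gamma> s - c) \<bullet> k) has_real_derivative y \<bullet> k) (at 0)" for k
    using bounded_linear.has_vector_derivative[OF bounded_linear_inner_left g(3), of k]
    by (auto simp: has_real_derivative_iff_has_vector_derivative inner_diff_left
        intro!: derivative_eq_intros)
  have "((\<lambda>s. (((\<gamma> s - c) \<bullet> u) / a)\<^sup>2 + (((\<gamma> s - c) \<bullet> v) / b)\<^sup>2) has_real_derivative
      2 * (Re z * (y \<bullet> u) / a + Im z * (y \<bullet> v) / b)) (at 0)"
    using a_pos b_pos
    by (auto intro!: derivative_eq_intros d simp: g(2) point_def inner_add_left inner_simps
        field_simps power2_eq_square power4_eq_xxxx)
  moreover have "(\<lambda>s. (((\<gamma> s - c) \<bullet> u) / a)\<^sup>2 + (((\<gamma> s - c) \<bullet> v) / b)\<^sup>2) = (\<lambda>s. 1)"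
    using g(1) unfolding X_def by auto
  ultimately have "2 * (Re z * (y \<bullet> u) / a + Im z * (y \<bullet> v) / b) = 0"
    using DERIV_const DERIV_unique by metis
  then have 0: "Re z * (y \<bullet> u) * b + Im z * (y \<bullet> v) * a = 0"
    using a_pos b_pos by (simp add: field_simps)
  have zz: "(Re z)^2 + (Im z)^2 = 1" using z by (metis cmod_power2 power_one)
  define t where "t = Re z * (y \<bullet> v) / b - Im z * (y \<bullet> u) / a"
  have tab: "t * a * b = Re z * (y \<bullet> v) * a - Im z * (y \<bullet> u) * b"
    unfolding t_def using a_pos b_pos by (simp add: field_simps)
  have "b * (y \<bullet> u) = b * (- (t * a * Im z))" "a * (y \<bullet> v) = a * (t * b * Re z)"
    using tab 0 zz by algebra+
  then have "y \<bullet> u = - (t * a * Im z)" "y \<bullet> v = t * b * Re z"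
    using a_pos b_pos by (metis less_irrefl mult_left_cancel)+
  then have "y = t *\<^sub>R tangent z"
    using orthonormal_expand_real2[OF norm_u norm_v uv, of y]
    unfolding tangent_def by (simp add: scaleR_add_right algebra_simps)
  then show "\<exists>t. y = t *\<^sub>R tangent z" ..
next
  assume "\<exists>t. y = t *\<^sub>R tangent z"
  then obtain t where t: "y = t *\<^sub>R tangent z" ..
  define \<gamma> where "\<gamma> s = point (z * cis (t * s))" for s
  have "(\<gamma> has_vector_derivative y) (at 0)"
    unfolding \<gamma>_def point_def t tangent_def
    by (auto intro!: derivative_eq_intros simp: scaleR_add_right algebra_simps)
  moreover have "range \<gamma> \<subseteq> X" unfolding \<gamma>_def using z by (auto simp: point_in_X norm_mult)
  moreover have "\<gamma> 0 = point z" unfolding \<gamma>_def by simp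
  ultimately show "tangent_vector X (point z) y" unfolding tangent_vector_def by blast
qed

lemma inner_tangent: "(point \<xi> - point z) \<bullet> tangent z = nf \<xi> z"
  unfolding point_def tangent_def normal_form_def
  by (simp add: inner_simps inner_diff_left inner_add_left inner_add_right algebra_simps power2_eq_square)

lemma orthogonal_tangent_iff:
  assumes "cmod z = 1"
  shows "(\<forall>y. tangent_vector X (point z) y \<longrightarrow> orthogonal x y) \<longleftrightarrow> x \<bullet> tangent z = 0"
  unfolding tangent_vector_point[OF assms] orthogonal_def
  by (auto simp: dest: spec[of _ "1 *\<^sub>R tangent z"])

lemma normal_line_point:
  assumes "cmod z = 1"
  shows "point \<xi> \<in> normal_line X (point z) \<longleftrightarrow> nf \<xi> z = 0"
  unfolding normal_line_def by (simp add: orthogonal_tangent_iff[OF assms] inner_tangent)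

text \<open>The equations for the common point in \<open>concurrent_iff\<close> always have a
  solution, so concurrency reduces to the reality condition.\<close>

lemma orthotripods_eq: "orthotripods X = {M \<in> real_triples X chart. card (set_mset M) = 3}"
proof (rule set_eqI)
  fix M
  show "M \<in> orthotripods X \<longleftrightarrow> M \<in> {M \<in> real_triples X chart. card (set_mset M) = 3}"
  proof (cases "size M = 3 \<and> card (set_mset M) = 3 \<and> set_mset M \<subseteq> X")
    case True
    then obtain p q s where M: "M = {#p, q, s#}" by (auto elim: size_3_obtain)
    define x y z where xyz: "x = chart p" "y = chart q" "z = chart s"
    have X: "p \<in> X" "q \<in> X" "s \<in> X" using True M by auto
    then have u: "cmod x = 1" "cmod y = 1" "cmod z = 1" unfolding xyz by (auto simp: X_iff)
    have d: "x \<noteq> y" "y \<noteq> z" "z \<noteq> x"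
      using True M inj[OF X(1,2)] inj[OF X(2,3)] inj[OF X(3,1)] unfolding xyz
      by (auto simp: card_insert_if split: if_splits)
    have C: "a^2 - b^2 \<noteq> 0"
      using b_pos b_less_a by (simp add: power2_eq_iff)
    define r w where "r = Re (x * y + y * z + z * x)" and "w = x * y * z"
    have "M \<in> orthotripods X \<longleftrightarrow> (\<exists>\<xi>. nf \<xi> x = 0 \<and> nf \<xi> y = 0 \<and> nf \<xi> z = 0)"
    proof -
      have "M \<in> orthotripods X \<longleftrightarrow> (\<exists>k. \<forall>p\<in>#M. k \<in> normal_line X p)"
        unfolding orthotripods_def using True by simp
      also have "\<dots> \<longleftrightarrow> (\<exists>\<xi>. \<forall>p\<in>#M. point \<xi> \<in> normal_line X p)" by (metis point_chart)
      also have "\<dots> \<longleftrightarrow> (\<exists>\<xi>. nf \<xi> x = 0 \<and> nf \<xi> y = 0 \<and> nf \<xi> z = 0)"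
        unfolding M using normal_line_point[OF u(1)] normal_line_point[OF u(2)] normal_line_point[OF u(3)]
        by (simp add: xyz point_chart)
      finally show ?thesis .
    qed
    also have "\<dots> \<longleftrightarrow> Im (x * y + y * z + z * x) = 0"
    proof -
      define \<xi> where "\<xi> = Complex ((a^2 - b^2) * (r - 1) * Re w / (2 * a^2)) (- ((a^2 - b^2) * (r
          + 1) * Im w) / (2 * b^2))"
      have "2 * a^2 * Re \<xi> = (a^2 - b^2) * (r - 1) * Re w \<and> 2 * b^2 * Im \<xi> = - ((a^2 - b^2) * (r
          + 1) * Im w)"
        unfolding \<xi>_def using a_pos b_pos by simp
      then show ?thesis
        unfolding concurrent_iff[OF u d refl C] r_def[symmetric] w_def[symmetric] by blast
    qed
    also have "\<dots> \<longleftrightarrow> M \<in> real_triples X chart"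
      unfolding M xyz triple_in_real_triples[OF X] ..
    finally show ?thesis using True by blast
  next
    case False
    then show ?thesis unfolding orthotripods_def real_triples_def by auto
  qed
qed

text \<open>Balance at a vertex forces the other two to lie on opposite sides of its normal. Holding
  at all three vertices, this puts the common point \<xi> inside the triangle.\<close>

lemma balanced_iff:
  assumes u: "cmod x = 1" "cmod y = 1" "cmod z = 1" and d: "x \<noteq> y" "y \<noteq> z" "z \<noteq> x"
    and n: "nf \<xi> x = 0" "nf \<xi> y = 0" "nf \<xi> z = 0"
  shows "positively_balanced X {#point x, point y, point z#} \<longleftrightarrow>
    0 < signed_area \<xi> x y * signed_area \<xi> y z \<and> 0 < signed_area \<xi> y z * signed_area \<xi> z x
        \<and> 0 < signed_area \<xi> z x * signed_area \<xi> x y"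
proof -
  define \<delta> where "\<delta> s t = dist (point s) (point t) ^ 3" for s t
  have sym: "\<delta> s t = \<delta> t s" for s t unfolding \<delta>_def by (simp add: dist_commute)
  have pos: "0 < \<delta> s t" if "s \<noteq> t" for s t using that unfolding \<delta>_def by (simp add: point_eq_iff)
  have force: "(\<forall>w. tangent_vector X (point x) w \<longrightarrow>
        orthogonal (coulomb_force k {point x, point y, point z} (point x)) w) \<longleftrightarrow>
      k (point y) / \<delta> x y * nf y x + k (point z) / \<delta> x z * nf z x = 0"
    if "cmod x = 1" "x \<noteq> y" "y \<noteq> z" "z \<noteq> x" "0 < k (point x)" for x y z k
  proof -
    have "coulomb_force k {point x, point y, point z} (point x) \<bullet> tangent x
      = - (k (point x) * (k (point y) / \<delta> x y * nf y x + k (point z) / \<delta> x z * nf z x))"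
      using that unfolding inner_tangent[symmetric]
      by (subst coulomb_force_triple)
        (auto simp: point_eq_iff inner_add_left inner_diff_left algebra_simps \<delta>_def)
    then show ?thesis
      unfolding orthogonal_tangent_iff[OF that(1)] using that(5) by simp
  qed
  have perm: "{point x, point y, point z} = {point y, point z, point x}"
    "{point x, point y, point z} = {point z, point x, point y}" by auto
  define tangential_balance where "tangential_balance k \<longleftrightarrow>
    k (point y) / \<delta> x y * nf y x + k (point z) / \<delta> x z * nf z x = 0 \<and>
    k (point z) / \<delta> y z * nf z y + k (point x) / \<delta> y x * nf x y = 0 \<and>
    k (point x) / \<delta> z x * nf x z + k (point y) / \<delta> z y * nf y z = 0" for k
  have pb: "positively_balanced X {#point x, point y, point z#} \<longleftrightarrow>
    (\<exists>k. 0 < k (point x) \<and> 0 < k (point y) \<and> 0 < k (point z) \<and> tangential_balance k)"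
  proof -
    have "((\<forall>p\<in>#{#point x, point y, point z#}. 0 < k p) \<and>
       (\<forall>p\<in>#{#point x, point y, point z#}. \<forall>w. tangent_vector X p w \<longrightarrow>
          orthogonal (coulomb_force k (set_mset {#point x, point y, point z#}) p) w)) \<longleftrightarrow>
      (0 < k (point x) \<and> 0 < k (point y) \<and> 0 < k (point z) \<and> tangential_balance k)" for k
      using force[OF u(1) d, of k] force[OF u(2) d(2,3,1), of k, folded perm(1)]
        force[OF u(3) d(3,1,2), of k, folded perm(2)]
      unfolding tangential_balance_def by (simp del: insert_iff) (auto simp del: insert_iff)
    then show ?thesis unfolding positively_balanced_def by blast
  qed
  have A: "0 < a^2" "0 < b^2" using a_pos b_pos by simp_all
  obtain tx where tx: "\<forall>y. signed_area \<xi> x y = - (tx * nf y x)" "\<forall>y. signed_area \<xi> y x = tx * nf y x"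
    by (rule signed_area_normal_form[OF u(1) A n(1)])
  obtain ty where ty: "\<forall>x. signed_area \<xi> y x = - (ty * nf x y)" "\<forall>x. signed_area \<xi> x y = ty * nf x y"
    by (rule signed_area_normal_form[OF u(2) A n(2)])
  obtain tz where tz: "\<forall>x. signed_area \<xi> z x = - (tz * nf x z)" "\<forall>x. signed_area \<xi> x z = tz * nf x z"
    by (rule signed_area_normal_form[OF u(3) A n(3)])
  note dd = d d[symmetric]
  define S1 S2 S3 where S: "S1 = signed_area \<xi> y z" "S2 = signed_area \<xi> z x" "S3 = signed_area \<xi> x y"
  have sx: "S3 = - (tx * nf y x)" "S2 = tx * nf z x" unfolding S using tx by auto
  have sy: "S1 = - (ty * nf z y)" "S3 = ty * nf x y" unfolding S using ty by auto
  have sz: "S2 = - (tz * nf x z)" "S1 = tz * nf y z" unfolding S using tz by auto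
  show ?thesis unfolding S[symmetric]
  proof
    assume "positively_balanced X {#point x, point y, point z#}"
    then obtain k where k: "0 < k (point x)" "0 < k (point y)" "0 < k (point z)" "tangential_balance k"
      unfolding pb by blast
    have "nf y x * nf z x < 0"
      using k dd pos normal_form_not_both_zero[OF u d A] unfolding tangential_balance_def
      by (intro opposite_signs[of "k (point y) / \<delta> x y" "k (point z) / \<delta> x z"]) auto
    moreover have "nf z y * nf x y < 0"
      using k dd pos normal_form_not_both_zero[OF u(2,3,1) d(2,3,1) A] unfolding tangential_balance_def
      by (intro opposite_signs[of "k (point z) / \<delta> y z" "k (point x) / \<delta> y x"]) auto
    moreover have "nf x z * nf y z < 0"
      using k dd pos normal_form_not_both_zero[OF u(3,1,2) d(3,1,2) A] unfolding tangential_balance_def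
      by (intro opposite_signs[of "k (point x) / \<delta> z x" "k (point y) / \<delta> z y"]) auto
    ultimately have neg: "nf y x * nf z x < 0" "nf z y * nf x y < 0" "nf x z * nf y z < 0" .
    have D: "S3 + S1 + S2 \<noteq> 0" unfolding S by (rule signed_area_vertex_nonzero[OF u d])
    \<comment> \<open>If \<open>tx = 0\<close>, then \<open>S2\<close> and \<open>S3\<close> vanish,
      so \<open>S1\<close> does not and \<open>ty\<close> is nonzero. Then
      \<open>nf x y = 0\<close>, against \<open>neg\<close>; the other cases are alike.\<close>
    have "tx \<noteq> 0 \<and> ty \<noteq> 0 \<and> tz \<noteq> 0"
      using sx sy sz D neg by (auto simp: mult_less_0_iff)
    moreover have "S3 * S2 = tx^2 * - (nf y x * nf z x)" "S1 * S3 = ty^2 * - (nf z y * nf x y)"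
      "S2 * S1 = tz^2 * - (nf x z * nf y z)"
      using sx sy sz by algebra+
    moreover have "0 < t^2 * - q" if "t \<noteq> 0" "q < 0" for t q :: real
      using that by (intro mult_pos_pos) auto
    ultimately have "0 < S3 * S2" "0 < S1 * S3" "0 < S2 * S1" using neg by metis+
    then show "0 < S3 * S1 \<and> 0 < S1 * S2 \<and> 0 < S2 * S3" by (metis mult.commute)
  next
    assume p: "0 < S3 * S1 \<and> 0 < S1 * S2 \<and> 0 < S2 * S3"
    \<comment> \<open>The charge at a vertex is the opposite area divided by the cubed length of the
      opposite side. At each vertex the two weights then share a denominator, and balance becomes an
      identity such as \<open>|S2| * S3 = |S3| * S2\<close>.\<close>
    define k where "k q = (if q = point x then \<bar>S1\<bar> / \<delta> y z else if q = point y then \<bar>S2\<bar> / \<delta> z x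
      else \<bar>S3\<bar> / \<delta> x y)" for q
    have k: "k (point x) = \<bar>S1\<bar> / \<delta> y z" "k (point y) = \<bar>S2\<bar> / \<delta> z x" "k (point z) = \<bar>S3\<bar> / \<delta> x y"
      unfolding k_def using dd by (auto simp: point_eq_iff)
    have S0: "S1 \<noteq> 0" "S2 \<noteq> 0" "S3 \<noteq> 0" using p by auto
    have t0: "tx \<noteq> 0" "ty \<noteq> 0" "tz \<noteq> 0" using S0 sx sy sz by auto
    have e: "\<bar>s\<bar> * q = \<bar>q\<bar> * s" if "0 < s * q" for s q :: real
      using that by (auto simp: zero_less_mult_iff)
    have cancel: "m / d1 / d2 * f + m' / d2 / d1 * g = 0"
      if "t \<noteq> 0" "m * (t * f) + m' * (t * g) = 0" for t m m' f g d1 d2 :: real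
    proof -
      have "t * (m * f + m' * g) = 0" using that(2) by algebra
      then have "m * f + m' * g = 0" using that(1) by simp
      then have "(m * f + m' * g) / (d1 * d2) = 0" by simp
      then show ?thesis by (simp add: add_divide_distrib mult.commute)
    qed
    have "tangential_balance k" unfolding tangential_balance_def k
    proof (intro conjI)
      have "\<bar>S2\<bar> * (tx * nf y x) + \<bar>S3\<bar> * (tx * nf z x) = 0"
        using e[of S2 S3] p sx by simp
      from cancel[OF t0(1) this, of "\<delta> z x" "\<delta> x y"]
      show "\<bar>S2\<bar> / \<delta> z x / \<delta> x y * nf y x + \<bar>S3\<bar> / \<delta> x y / \<delta> x z * nf z x = 0"
        by (simp add: sym[of x z])
      have "\<bar>S3\<bar> * (ty * nf z y) + \<bar>S1\<bar> * (ty * nf x y) = 0"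
        using e[of S3 S1] p sy by simp
      from cancel[OF t0(2) this, of "\<delta> x y" "\<delta> y z"]
      show "\<bar>S3\<bar> / \<delta> x y / \<delta> y z * nf z y + \<bar>S1\<bar> / \<delta> y z / \<delta> y x * nf x y = 0"
        by (simp add: sym[of y x])
      have "\<bar>S1\<bar> * (tz * nf x z) + \<bar>S2\<bar> * (tz * nf y z) = 0"
        using e[of S1 S2] p sz by simp
      from cancel[OF t0(3) this, of "\<delta> y z" "\<delta> z x"]
      show "\<bar>S1\<bar> / \<delta> y z / \<delta> z x * nf x z + \<bar>S2\<bar> / \<delta> z x / \<delta> z y * nf y z = 0"
        by (simp add: sym[of z y])
    qed
    moreover have "0 < k (point x)" "0 < k (point y)" "0 < k (point z)"
      unfolding k using S0 dd pos by auto
    ultimately show "positively_balanced X {#point x, point y, point z#}" unfolding pb by blast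
  qed
qed

section \<open>The two homeomorphisms for the ellipse\<close>

abbreviation "triples \<equiv> sym_cube (top_of_set X)"

lemma real_triples_subset: "real_triples X chart \<subseteq> topspace triples"
  using closedin_real_triples by (rule closedin_subset)

text \<open>Real triples are closed. For the other inclusion, density of the strict inequality in
  \<open>roots_region\<close> is carried back along \<open>coords chart\<close>.\<close>

lemma closure_of_orthotripods: "triples closure_of orthotripods X = real_triples X chart"
proof
  show "triples closure_of orthotripods X \<subseteq> real_triples X chart"
    by (rule closure_of_minimal[OF _ closedin_real_triples]) (auto simp: orthotripods_eq)
  have img: "coords chart ` orthotripods X = {p \<in> roots_region. triple_disc (fst p) (snd p) < 0}"
    unfolding orthotripods_eq coords_image[symmetric] using triple_disc_coords(2) by auto
  have "coords chart ` (subtopology triples (real_triples X chart) closure_of orthotripods X) =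
      top_of_set roots_region closure_of (coords chart ` orthotripods X)"
    using real_triples_subset
    by (intro homeomorphic_map_closure_of[OF homeomorphic_map_coords, symmetric]) (auto simp:
        orthotripods_eq)
  also have "\<dots> = roots_region"
    unfolding img closure_of_subtopology using roots_region_subset_closure
    by (auto simp: Collect_conj_eq Int_absorb1 subset_iff)
  finally have 1: "coords chart ` (subtopology triples (real_triples X chart) closure_of orthotripods X) =
     coords chart ` real_triples X chart" unfolding coords_image .
  have "real_triples X chart \<subseteq> subtopology triples (real_triples X chart) closure_of orthotripods X"
  proof
    fix M assume M: "M \<in> real_triples X chart"
    then have "coords chart M \<in> coords chart ` (subtopology triples (real_triples X chart)
        closure_of orthotripods X)"
      unfolding 1 by (rule imageI)
    then obtain N where N: "coords chart M = coords chart N"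
      "N \<in> subtopology triples (real_triples X chart) closure_of orthotripods X"
      by (rule imageE)
    have top: "topspace (subtopology triples (real_triples X chart)) = real_triples X chart"
      using real_triples_subset by (rule topspace_subtopology_subset)
    have "N \<in> real_triples X chart"
      using closure_of_subset_subtopology N(2) by (rule subsetD)
    then have "M = N"
      by (rule inj_onD[OF homeomorphic_imp_injective_map[OF homeomorphic_map_coords, unfolded top] N(1) M])
    then show "M \<in> subtopology triples (real_triples X chart) closure_of orthotripods X"
      using N(2) by simp
  qed
  also have "\<dots> \<subseteq> triples closure_of orthotripods X"
    by (rule closure_of_subtopology_subset)
  finally show "real_triples X chart \<subseteq> triples closure_of orthotripods X" .
qed

lemma balanced_coords:
  assumes M: "M \<in> real_triples X chart"
  shows "M \<in> orthotripods X \<and> positively_balanced X M \<longleftrightarrow> coords chart M \<in> balance_region (a^2) (b^2)"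
proof -
  obtain p q s where pqs: "M = {#p, q, s#}" and X: "p \<in> X" "q \<in> X" "s \<in> X"
    and e: "chart p + chart q + chart s = snd (coords chart M) * fst (coords chart M)"
    "chart p * chart q + chart q * chart s + chart s * chart p = snd (coords chart M)"
    "chart p * chart q * chart s = fst (coords chart M)"
    using M by (rule real_triple_obtain)
  define x y z where xyz: "x = chart p" "y = chart q" "z = chart s"
  define w r where wr: "w = fst (coords chart M)" "r = snd (coords chart M)"
  have u: "cmod x = 1" "cmod y = 1" "cmod z = 1" using X by (auto simp: xyz X_iff)
  note e' = e[folded xyz wr]
  have w: "cmod w = 1" using u by (simp add: e'(3)[symmetric] norm_mult)
  have card: "M \<in> orthotripods X \<longleftrightarrow> triple_disc w r < 0"
    unfolding orthotripods_eq wr using M triple_disc_coords(2)[OF M] by simp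
  have AB: "0 < b^2" "b^2 < a^2" using b_pos b_less_a by (simp_all add: power_strict_mono)
  have "positively_balanced X M \<longleftrightarrow> -1 < r \<and> r < 1 \<and> 0 < balance_form (a^2) (b^2) w r" if d:
      "triple_disc w r < 0"
  proof -
    have d: "x \<noteq> y" "y \<noteq> z" "z \<noteq> x" using d triple_disc_eq_dist[OF u e'] by auto
    define \<xi> where "\<xi> = Complex ((a^2 - b^2) * (r - 1) * Re w / (2 * a^2)) (- ((a^2 - b^2) * (r + 1)
        * Im w) / (2 * b^2))"
    have xi: "2 * a^2 * Re \<xi> = (a^2 - b^2) * (r - 1) * Re w" "2 * b^2 * Im \<xi> = - ((a^2 - b^2) * (r
        + 1) * Im w)"
      unfolding \<xi>_def using a_pos b_pos by simp_all
    have C: "a^2 - b^2 \<noteq> 0" using AB by simp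
    have n: "nf \<xi> x = 0 \<and> nf \<xi> y = 0 \<and> nf \<xi> z = 0"
      unfolding concurrent_iff[OF u d refl C] e'(2,3) using xi by simp
    have "M = {#point x, point y, point z#}" unfolding pqs xyz by (simp add: point_chart)
    then show ?thesis
      using balanced_iff[OF u d, of \<xi>] n center_in_triangle_iff[OF u d e'(3)[symmetric] e'(1,2) AB xi]
      by metis
  qed
  \<comment> \<open>The balance condition alone already makes the three points distinct.\<close>
  moreover have "triple_disc w r < 0" if "-1 < r" "r < 1"
    using triple_disc_neg_if_abs_less_1[OF w, of r] that by simp
  ultimately show ?thesis
    unfolding card balance_region_def mem_Collect_eq wr[symmetric] using w by blast
qed

lemma balanced_orthotripods_homeomorphic:
  "subtopology triples {M \<in> orthotripods X. positively_balanced X M} homeomorphic_space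
    cylinder {0<..<1}"
proof -
  let ?S = "{M \<in> orthotripods X. positively_balanced X M}"
  have S: "?S \<subseteq> real_triples X chart" by (auto simp: orthotripods_eq)
  have "coords chart ` ?S = balance_region (a^2) (b^2)"
  proof
    show "coords chart ` ?S \<subseteq> balance_region (a^2) (b^2)" using balanced_coords S by blast
    show "balance_region (a^2) (b^2) \<subseteq> coords chart ` ?S"
    proof
      fix p assume p: "p \<in> balance_region (a^2) (b^2)"
      then have "p \<in> coords chart ` real_triples X chart"
        unfolding coords_image using balance_region_subset by blast
      then show "p \<in> coords chart ` ?S" using p balanced_coords by blast
    qed
  qed
  then have "homeomorphic_map (subtopology (subtopology triples (real_triples X chart)) ?S)
      (subtopology (top_of_set roots_region) (balance_region (a^2) (b^2))) (coords chart)"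
    using S real_triples_subset balance_region_subset
    by (intro homeomorphic_map_subtopologies[OF homeomorphic_map_coords])
      (simp add: Int_absorb1 Int_absorb2 subset_trans)
  then have "subtopology triples ?S homeomorphic_space top_of_set (balance_region (a^2) (b^2))"
    using S balance_region_subset
    by (simp add: subtopology_subtopology Int_absorb1 homeomorphic_map_imp_homeomorphic_space)
  also have "top_of_set (balance_region (a^2) (b^2)) homeomorphic_space cylinder {0<..<1}"
    using b_pos b_less_a by (intro balance_region_homeomorphic_cylinder) (simp_all add: power_strict_mono)
  finally show ?thesis .
qed

lemma closure_orthotripods_homeomorphic:
  "subtopology triples (triples closure_of orthotripods X) homeomorphic_space cylinder {0..1}"
  unfolding closure_of_orthotripods
  using homeomorphic_map_imp_homeomorphic_space[OF homeomorphic_map_coords]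
    roots_region_homeomorphic_cylinder by (rule homeomorphic_space_trans)

end

text \<open>The longer semi-axis is called \<open>a\<close>, exchanging the axes if necessary; equal
  semi-axes give a circle by Pythagoras in the frame \<open>u\<close>, \<open>v\<close>.\<close>

lemma ellipse_obtain:
  assumes "is_ellipse X" and "\<not> is_circle X"
  obtains c u v a b where "ellipse u v a b" "X = ellipse.X c u v a b"
proof -
  obtain c u v a b where uv: "norm u = 1" "norm v = 1" "orthogonal u v" and ab: "0 < a" "0 < b"
    and X: "X = {p. (((p - c) \<bullet> u) / a)\<^sup>2 + (((p - c) \<bullet> v) / b)\<^sup>2 = 1}"
    using assms(1) unfolding is_ellipse_def by blast
  consider "b < a" | "a < b" | "a = b" by linarith
  then show thesis
  proof cases
    case 1
    then have "ellipse u v a b" using uv ab by unfold_locales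
    then show thesis using that X ellipse.X_def by blast
  next
    case 2
    then have e: "ellipse v u b a" using uv ab by unfold_locales (auto simp: orthogonal_commute)
    have "X = ellipse.X c v u b a" unfolding ellipse.X_def[OF e] X by (simp add: add.commute)
    then show thesis using that e by blast
  next
    case 3
    have "(norm q)\<^sup>2 = (q \<bullet> u)\<^sup>2 + (q \<bullet> v)\<^sup>2" for q :: "real^2"
    proof -
      have "q \<bullet> q = q \<bullet> ((q \<bullet> u) *\<^sub>R u + (q \<bullet> v) *\<^sub>R v)"
        using orthonormal_expand_real2[OF uv, of q] by simp
      then show ?thesis
        unfolding power2_norm_eq_inner by (simp add: inner_add_right power2_eq_square)
    qed
    then have n: "(((p - c) \<bullet> u) / a)\<^sup>2 + (((p - c) \<bullet> v) / b)\<^sup>2 = (norm (p - c))\<^sup>2 / a\<^sup>2" for p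
      unfolding 3[symmetric] by (simp add: power_divide add_divide_distrib)
    have "(norm (p - c))\<^sup>2 / a\<^sup>2 = 1 \<longleftrightarrow> norm (p - c) = a" for p
      using ab by (auto simp: power2_eq_iff_nonneg)
    then have "X = {p. norm (p - c) = a}" unfolding X n by simp
    then have "X = sphere c a" by (simp add: sphere_def dist_norm norm_minus_commute)
    then show thesis using assms(2) ab unfolding is_circle_def by blast
  qed
qed

theorem proposition4:
  fixes X :: "(real^2) set"
  assumes "is_ellipse X" and "\<not> is_circle X"
  shows "subtopology (sym_cube (top_of_set X)) (sym_cube (top_of_set X) closure_of orthotripods X)
           homeomorphic_space cylinder {0..1}
       \<and> (\<exists>I :: real set. is_interval I \<and> (\<exists>x\<in>I. \<exists>y\<in>I. x < y) \<and>
           subtopology (sym_cube (top_of_set X)) {P \<in> orthotripods X. positively_balanced X P}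
             homeomorphic_space cylinder I)"
proof -
  obtain c u v a b where e: "ellipse u v a b" and X: "X = ellipse.X c u v a b"
    using assms by (rule ellipse_obtain)
  interpret ellipse c u v a b by (rule e)
  have "is_interval {0<..<1::real}" by (rule is_interval_oo)
  moreover have "\<exists>x\<in>{0<..<1::real}. \<exists>y\<in>{0<..<1}. x < y"
    by (intro bexI[of _ "1/3"] bexI[of _ "1/2"]) auto
  ultimately show ?thesis
    unfolding X using closure_orthotripods_homeomorphic balanced_orthotripods_homeomorphic by blast
qed

end
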